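(* Let $R$ be a (commutative) noetherian ring and $n$ a positive integer. Then the ring $R[T_1,\ldots,T_n]_{\mathbb{Q}}$ is coherent.
   Context: For a commutative ring $R$, the ring of polynomials with rational degree in $n$ variables is the direct limit (union) $R[T_1,\ldots,T_n]_{\mathbb{Q}}=\bigcup_{i\ge 1} R[T_1,T_1^{1/2},\ldots,T_1^{1/i},\ldots,T_n,T_n^{1/2},\ldots,T_n^{1/i}]$, where the $T_j^{1/i}$ are formally adjoined compatible roots of $T_j$. Equivalently, its elements are finite $R$-linear combinations of monomials $T_1^{r_1}\cdots T_n^{r_n}$ with $r_j\in\mathbb{Q}_{\ge 0}$, with exponents adding under multiplication. A commutative ring is coherent if every finitely generated ideal is finitely presented as a module. *)

theory Defs
  imports Complex_Main "HOL-Algebra.Module" "HOL-Algebra.Ring_Divisibility"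
begin

section \<open>Polynomials with rational degree\<close>

text \<open>A tuple of exponents in \<open>\<rat>\<^sub>\<ge>\<^sub>0\<^sup>n\<close> is a function on \<^typ>\<open>nat\<close> that vanishes outside \<open>{..<n}\<close>;
  it stands for the monomial \<open>T\<^sub>0\<^bsup>a 0\<^esup> \<cdots> T\<^sub>n\<^sub>-\<^sub>1\<^bsup>a (n - 1)\<^esup>\<close>.\<close>

definition rat_exponents :: "nat \<Rightarrow> (nat \<Rightarrow> rat) set"
  where "rat_exponents n = {a. (\<forall>j. 0 \<le> a j) \<and> (\<forall>j\<ge>n. a j = 0)}"

text \<open>\<open>R[T\<^sub>1,\<dots>,T\<^sub>n]\<^sub>\<rat>\<close> is the monoid algebra of \<^term>\<open>rat_exponents n\<close> over \<open>R\<close>: an element is the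
  finitely supported family of its coefficients. In a product the sum ranges over pairs of
  exponents in the supports only, since a nonzero exponent has infinitely many decompositions.\<close>

definition rat_poly_ring :: "('a, 'm) ring_scheme \<Rightarrow> nat \<Rightarrow> ((nat \<Rightarrow> rat) \<Rightarrow> 'a) ring"
  where "rat_poly_ring R n = \<lparr>
    carrier = {p. (\<forall>c. p c \<in> carrier R) \<and> finite {c. p c \<noteq> \<zero>\<^bsub>R\<^esub>} \<and>
                  {c. p c \<noteq> \<zero>\<^bsub>R\<^esub>} \<subseteq> rat_exponents n},
    monoid.mult = (\<lambda>p q c. finsum R (\<lambda>(a, b). p a \<otimes>\<^bsub>R\<^esub> q b)
              {(a, b). p a \<noteq> \<zero>\<^bsub>R\<^esub> \<and> q b \<noteq> \<zero>\<^bsub>R\<^esub> \<and> (\<lambda>j. a j + b j) = c}),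
    one = (\<lambda>c. if c = (\<lambda>j. 0) then \<one>\<^bsub>R\<^esub> else \<zero>\<^bsub>R\<^esub>),
    ring.zero = (\<lambda>c. \<zero>\<^bsub>R\<^esub>),
    add = (\<lambda>p q c. p c \<oplus>\<^bsub>R\<^esub> q c)\<rparr>"


section \<open>Finitely presented modules and coherent rings\<close>

text \<open>The fields \<open>mult\<close> and \<open>one\<close> of a module record play no role in the locale
  \<^locale>\<open>module\<close>.\<close>

definition free_module :: "('a, 'm) ring_scheme \<Rightarrow> nat \<Rightarrow> ('a, nat \<Rightarrow> 'a) module"
  where "free_module R k = \<lparr>
    carrier = {..<k} \<rightarrow>\<^sub>E carrier R,
    monoid.mult = (\<lambda>v w. \<lambda>i\<in>{..<k}. v i \<otimes>\<^bsub>R\<^esub> w i),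
    one = (\<lambda>i\<in>{..<k}. \<one>\<^bsub>R\<^esub>),
    ring.zero = (\<lambda>i\<in>{..<k}. \<zero>\<^bsub>R\<^esub>),
    add = (\<lambda>v w. \<lambda>i\<in>{..<k}. v i \<oplus>\<^bsub>R\<^esub> w i),
    smult = (\<lambda>r v. \<lambda>i\<in>{..<k}. r \<otimes>\<^bsub>R\<^esub> v i)\<rparr>"

definition ideal_module :: "('a, 'm) ring_scheme \<Rightarrow> 'a set \<Rightarrow> ('a, 'a) module"
  where "ideal_module R I = \<lparr>
    carrier = I,
    monoid.mult = monoid.mult R,
    one = one R,
    ring.zero = ring.zero R,
    add = add R,
    smult = monoid.mult R\<rparr>"

definition module_homs ::
  "('a, 'm) ring_scheme \<Rightarrow> ('a, 'b, 'k) module_scheme \<Rightarrow> ('a, 'c, 'l) module_scheme \<Rightarrow> ('b \<Rightarrow> 'c) set"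
  where "module_homs R M N = {f \<in> carrier M \<rightarrow> carrier N.
    (\<forall>x\<in>carrier M. \<forall>y\<in>carrier M. f (x \<oplus>\<^bsub>M\<^esub> y) = f x \<oplus>\<^bsub>N\<^esub> f y) \<and>
    (\<forall>r\<in>carrier R. \<forall>x\<in>carrier M. f (r \<odot>\<^bsub>M\<^esub> x) = r \<odot>\<^bsub>N\<^esub> f x)}"

text \<open>There is an exact sequence \<open>R\<^sup>m \<rightarrow> R\<^sup>k \<rightarrow> M \<rightarrow> 0\<close>.\<close>

definition finitely_presented :: "('a, 'm) ring_scheme \<Rightarrow> ('a, 'b, 'k) module_scheme \<Rightarrow> bool"
  where "finitely_presented R M \<longleftrightarrow> module R M \<and>
    (\<exists>m k. \<exists>\<phi>\<in>module_homs R (free_module R m) (free_module R k).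
      \<exists>\<psi>\<in>module_homs R (free_module R k) M.
        \<psi> ` carrier (free_module R k) = carrier M \<and>
        \<phi> ` carrier (free_module R m) = {v \<in> carrier (free_module R k). \<psi> v = \<zero>\<^bsub>M\<^esub>})"

locale coherent_ring = cring +
  assumes fin_gen_ideal_fin_pres:
    "\<lbrakk>S \<subseteq> carrier R; finite S\<rbrakk> \<Longrightarrow> finitely_presented R (ideal_module R (Idl S))"

end

theory Submission
  imports Defs "HOL-Library.Function_Algebras" "HOL-Library.List_Lenlexorder"
begin

text \<open>Let \<open>A = R[T\<^sub>1,\<dots>,T\<^sub>n]\<^sub>\<rat>\<close> and \<open>f\<^sub>0,\<dots>,f\<^sub>k\<^sub>-\<^sub>1 \<in> A\<close>, and choose \<open>d > 0\<close> such that all exponents of the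
  \<open>f\<^sub>j\<close> lie in the group \<open>\<Gamma>\<close> of exponents with denominator \<open>d\<close>. The syzygies of \<open>f\<close> with exponents
  in \<open>\<Gamma>\<close> form a module over the noetherian ring \<open>R[T\<^sub>1\<^sup>1\<^sup>/\<^sup>d,\<dots>,T\<^sub>n\<^sup>1\<^sup>/\<^sup>d]\<close>, so they are finitely
  generated. Rather than from the Hilbert basis theorem, this follows from a Groebner basis argument
  that works directly with tuples: the ideals of leading coefficients grow along the monomials, and
  Dickson's lemma together with the ascending chain condition in \<open>R\<close> leaves finitely many of them
  to consider. Finally, \<open>A\<close> is free over that subring on the monomials \<open>T\<^sup>e\<close> with all \<open>e\<^sub>j \<in> [0, 1/d)\<close>:
  splitting a syzygy according to the residues of its exponents modulo \<open>\<Gamma>\<close> writes it as a sum of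
  \<open>T\<^sup>e h\<close> where \<open>h\<close> is a syzygy with exponents in \<open>\<Gamma>\<close>. Hence the same generators generate all
  syzygies over \<open>A\<close>.\<close>

section \<open>Dickson's lemma and Groebner bases over a noetherian ring\<close>

section \<open>Leading coefficients\<close>

text \<open>Any sequence in a linear order has a monotone subsequence. If that one decreases, the
  well-order makes it attain its least value, and it is constant from there on, hence also
  nondecreasing.\<close>

lemma incseq_subseq:
  fixes s :: "nat \<Rightarrow> 'w::wellorder"
  obtains \<phi> where "strict_mono \<phi>" "incseq (s \<circ> \<phi>)"
proof -
  obtain \<phi> :: "nat \<Rightarrow> nat" where \<phi>: "strict_mono \<phi>" "monoseq (\<lambda>i. s (\<phi> i))"
    using seq_monosub by blast
  show thesis
  proof (cases "incseq (s \<circ> \<phi>)")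
    case True
    then show thesis using \<phi> that by blast
  next
    case False
    then have dec: "s (\<phi> j) \<le> s (\<phi> i)" if "i \<le> j" for i j
      using \<phi>(2) that by (auto simp: monoseq_def incseq_def)
    obtain m where "s (\<phi> m) = (LEAST y. y \<in> range (s \<circ> \<phi>))"
      using LeastI[of "\<lambda>y. y \<in> range (s \<circ> \<phi>)" "s (\<phi> 0)"] by auto
    then have m: "s (\<phi> m) \<le> s (\<phi> i)" for i
      by (auto intro: Least_le)
    have "s (\<phi> (m + i)) = s (\<phi> m)" for i
      using m dec by (simp add: antisym)
    then have "incseq (s \<circ> (\<lambda>i. \<phi> (m + i)))"
      by (simp add: incseq_def)
    moreover have "strict_mono (\<lambda>i. \<phi> (m + i))"
      using \<phi>(1) by (simp add: strict_mono_def)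
    ultimately show thesis using that by blast
  qed
qed

text \<open>Dickson's lemma in sequence form, with the coordinates of a sequence of tuples as
  \<open>J\<close>. The sequences are treated one after the other, since passing to a further
  subsequence preserves monotonicity.\<close>

lemma common_incseq_subseq:
  fixes J :: "(nat \<Rightarrow> 'w::wellorder) set"
  assumes "finite J"
  shows "\<exists>\<phi>. strict_mono \<phi> \<and> (\<forall>s\<in>J. incseq (s \<circ> \<phi>))"
  using assms
proof (induction J)
  case empty
  show ?case by (auto intro: strict_mono_id)
next
  case (insert s J)
  then obtain \<phi> where \<phi>: "strict_mono \<phi>" "\<forall>s\<in>J. incseq (s \<circ> \<phi>)" by blast
  obtain \<rho> :: "nat \<Rightarrow> nat" where \<rho>: "strict_mono \<rho>" "incseq ((s \<circ> \<phi>) \<circ> \<rho>)"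
    by (rule incseq_subseq)
  have "strict_mono (\<phi> \<circ> \<rho>)"
    using \<phi>(1) \<rho>(1) by (simp add: strict_mono_def)
  moreover have "incseq (u \<circ> (\<phi> \<circ> \<rho>))" if "u \<in> insert s J" for u
    using that \<phi>(2) \<rho> by (auto simp: incseq_def strict_mono_less_eq)
  ultimately show ?case by blast
qed

text \<open>Vectors in \<open>M\<close> have coefficients indexed by generalized monomials \<open>X\<close>, ordered through \<open>key\<close>;
  \<open>T\<close> is the set of multiplications by monomials. \<open>bounded v x\<close> says that the leading monomial of
  \<open>v\<close> is at most \<open>x\<close>, also allowing \<open>v x = \<zero>\<close>, which makes leading coefficients form an ideal.\<close>

locale leading_terms = cring R + noetherian_ring R for R (structure) +
  fixes X :: "'x set" and key :: "'x \<Rightarrow> 'w::wellorder"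
    and T :: "(('x \<Rightarrow> 'a) \<Rightarrow> 'x \<Rightarrow> 'a) set" and M :: "('x \<Rightarrow> 'a) set"
    and bounded :: "('x \<Rightarrow> 'a) \<Rightarrow> 'x \<Rightarrow> bool" and dominated :: "'x \<Rightarrow> 'x \<Rightarrow> bool"
  defines "bounded v x \<equiv> \<forall>y. v y \<noteq> \<zero> \<longrightarrow> key y \<le> key x"
    and "dominated x y \<equiv> \<exists>t\<in>T. \<forall>v\<in>M. bounded v x \<longrightarrow> bounded (t v) y \<and> t v y = v x"
  assumes inj_key: "inj_on key X"
    and M_carrier: "v \<in> M \<Longrightarrow> v x \<in> carrier R"
    and M_finite: "v \<in> M \<Longrightarrow> finite {x. v x \<noteq> \<zero>}"
    and M_support: "\<lbrakk>v \<in> M; v x \<noteq> \<zero>\<rbrakk> \<Longrightarrow> x \<in> X"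
    and M_zero: "(\<lambda>x. \<zero>) \<in> M"
    and M_add: "\<lbrakk>u \<in> M; v \<in> M\<rbrakk> \<Longrightarrow> (\<lambda>x. u x \<oplus> v x) \<in> M"
    and M_smult: "\<lbrakk>r \<in> carrier R; v \<in> M\<rbrakk> \<Longrightarrow> (\<lambda>x. r \<otimes> v x) \<in> M"
    and M_T: "\<lbrakk>t \<in> T; v \<in> M\<rbrakk> \<Longrightarrow> t v \<in> M"
    and dominated_subseq: "(\<And>i. s i \<in> X) \<Longrightarrow>
      \<exists>\<phi> :: nat \<Rightarrow> nat. strict_mono \<phi> \<and> (\<forall>i j :: nat. i < j \<longrightarrow> dominated (s (\<phi> i)) (s (\<phi> j)))"
begin

definition lead_coeffs :: "('x \<Rightarrow> 'a) set \<Rightarrow> 'x \<Rightarrow> 'a set"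
  where "lead_coeffs N x = {v x | v. v \<in> N \<and> bounded v x}"

text \<open>The set \<open>N\<close> is kept general because two cases occur: \<open>M\<close>
  itself, and \<open>N \<inter> M\<close> for a candidate \<open>N\<close> in
  \<open>finitely_generated\<close>.\<close>

lemma lead_coeffs_ideal:
  assumes sub: "N \<subseteq> M" and zero: "(\<lambda>x. \<zero>) \<in> N"
    and add: "\<And>u v. \<lbrakk>u \<in> N; v \<in> N\<rbrakk> \<Longrightarrow> (\<lambda>x. u x \<oplus> v x) \<in> N"
    and smult: "\<And>r v. \<lbrakk>r \<in> carrier R; v \<in> N\<rbrakk> \<Longrightarrow> (\<lambda>x. r \<otimes> v x) \<in> N"
  shows "ideal (lead_coeffs N x) R"
proof -
  have smult': "r \<otimes> a \<in> lead_coeffs N x" if r: "r \<in> carrier R" and a: "a \<in> lead_coeffs N x" for r a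
  proof -
    obtain v where v: "a = v x" "v \<in> N" "bounded v x"
      using a by (auto simp: lead_coeffs_def)
    then have "bounded (\<lambda>y. r \<otimes> v y) x"
      using r unfolding bounded_def by (metis r_null)
    then show ?thesis
      using v smult[OF r v(2)] by (force simp: lead_coeffs_def)
  qed
  have carr: "lead_coeffs N x \<subseteq> carrier R"
    using sub M_carrier by (auto simp: lead_coeffs_def)
  show ?thesis
  proof (rule idealI)
    show "ring R" by (rule ring_axioms)
    show "subgroup (lead_coeffs N x) (add_monoid R)"
    proof (rule add.subgroupI)
      have "bounded (\<lambda>_. \<zero>) x" by (simp add: bounded_def)
      then show "lead_coeffs N x \<noteq> {}"
        using zero by (auto simp: lead_coeffs_def)
    next
      fix a assume a: "a \<in> lead_coeffs N x"
      then have "\<ominus> \<one> \<otimes> a \<in> lead_coeffs N x" using smult' by simp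
      then show "\<ominus> a \<in> lead_coeffs N x"
        using a carr by (auto simp: l_minus)
    next
      fix a b assume "a \<in> lead_coeffs N x" "b \<in> lead_coeffs N x"
      then obtain u v where uv: "a = u x" "u \<in> N" "bounded u x" "b = v x" "v \<in> N" "bounded v x"
        by (auto simp: lead_coeffs_def)
      then have "bounded (\<lambda>y. u y \<oplus> v y) x"
        unfolding bounded_def by (metis l_zero zero_closed)
      then show "a \<oplus> b \<in> lead_coeffs N x"
        using uv add[OF uv(2,5)] by (force simp: lead_coeffs_def)
    qed (use carr in auto)
  next
    fix a r assume "a \<in> lead_coeffs N x" "r \<in> carrier R"
    then show "r \<otimes> a \<in> lead_coeffs N x" "a \<otimes> r \<in> lead_coeffs N x"
      using smult'[of r a] carr m_comm[of a r] by auto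
  qed
qed

lemma lead_coeffs_M_ideal: "ideal (lead_coeffs M x) R"
  using M_zero M_add M_smult by (intro lead_coeffs_ideal) auto

lemma lead_coeffs_mono: "dominated x y \<Longrightarrow> lead_coeffs M x \<subseteq> lead_coeffs M y"
proof -
  assume "dominated x y"
  then obtain t where "t \<in> T" "\<And>v. \<lbrakk>v \<in> M; bounded v x\<rbrakk> \<Longrightarrow> bounded (t v) y \<and> t v y = v x"
    by (auto simp: dominated_def)
  then show ?thesis
    using M_T unfolding lead_coeffs_def by (smt (verit) Collect_mono_iff)
qed

text \<open>Otherwise one could choose points forever, none of them covered by an earlier one. Along
  a subsequence each point dominates the later ones, so the leading ideals ascend; they become
  stationary as \<open>R\<close> is noetherian, and two consecutive points then contradict the
  choice.\<close>

lemma finite_dominating_set: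
  obtains F where "finite F" "F \<subseteq> X"
    "\<And>x. x \<in> X \<Longrightarrow> \<exists>b\<in>F. dominated b x \<and> lead_coeffs M b = lead_coeffs M x"
proof (rule ccontr)
  note dom_set = that
  define P where "P b x \<longleftrightarrow> dominated b x \<and> lead_coeffs M b = lead_coeffs M x" for b x
  assume no_set: "\<not> thesis"
  have none: "\<exists>x\<in>X. \<forall>b\<in>F. \<not> P b x" if F: "finite F" "F \<subseteq> X" for F
  proof (rule ccontr)
    assume "\<not> ?thesis"
    then have "\<exists>b\<in>F. dominated b x \<and> lead_coeffs M b = lead_coeffs M x" if "x \<in> X" for x
      using that by (auto simp: P_def)
    then show False
      using no_set dom_set F by blast
  qed
  define next_pt where "next_pt F = (SOME x. x \<in> X \<and> (\<forall>b\<in>F. \<not> P b x))" for F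
  have next_pt: "next_pt F \<in> X" "\<And>b. b \<in> F \<Longrightarrow> \<not> P b (next_pt F)" if "finite F" "F \<subseteq> X" for F
    using someI_ex[of "\<lambda>x. x \<in> X \<and> (\<forall>b\<in>F. \<not> P b x)"] none[OF that]
    unfolding next_pt_def by blast+
  \<comment> \<open>\<open>G i\<close> collects the first \<open>i\<close> chosen points, and
    \<open>s i\<close> below is the point chosen against \<open>G i\<close>.\<close>
  define G where "G = rec_nat {} (\<lambda>_ F. insert (next_pt F) F)"
  have G_Suc: "G (Suc i) = insert (next_pt (G i)) (G i)" for i
    by (simp add: G_def)
  have G: "finite (G i) \<and> G i \<subseteq> X" for i
    by (induction i) (auto simp: G_Suc next_pt, auto simp: G_def)
  define s where "s i = next_pt (G i)" for i
  have sX: "s i \<in> X" for i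
    using G next_pt by (simp add: s_def)
  have "mono G"
    by (rule mono_iff_le_Suc[THEN iffD2]) (auto simp: G_Suc)
  then have "s i \<in> G j" if "i < j" for i j
    using that G_Suc[of i] monoD[of G "Suc i" j] by (auto simp: s_def)
  then have bad: "\<not> P (s i) (s j)" if "i < j" for i j
    using that G next_pt(2) by (simp add: s_def)
  obtain \<phi> :: "nat \<Rightarrow> nat"
    where \<phi>: "strict_mono \<phi>" "\<And>i j. i < j \<Longrightarrow> dominated (s (\<phi> i)) (s (\<phi> j))"
    using dominated_subseq[of s] sX by blast
  let ?L = "\<lambda>i. lead_coeffs M (s (\<phi> i))"
  have mono: "?L i \<subseteq> ?L j" if "i \<le> j" for i j
    using lead_coeffs_mono \<phi>(2) that by (cases "i = j") auto
  have "\<Union> (range ?L) \<in> range ?L"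
  proof (rule ideal_chain_is_trivial)
    show "subset.chain {I. ideal I R} (range ?L)"
    proof -
      have "?L i \<subseteq> ?L j \<or> ?L j \<subseteq> ?L i" for i j
        using mono[of i j] mono[of j i] by linarith
      then show ?thesis
        unfolding subset_chain_def using lead_coeffs_M_ideal by blast
    qed
  qed auto
  then obtain i where "\<Union> (range ?L) = ?L i" by blast
  moreover have "?L (Suc i) \<subseteq> \<Union> (range ?L)"
    by (rule Union_upper) simp
  ultimately have "?L i = ?L (Suc i)"
    using mono[of i "Suc i"] by simp
  then have "P (s (\<phi> i)) (s (\<phi> (Suc i)))"
    using \<phi>(2) by (simp add: P_def)
  then show False
    using bad \<phi>(1) by (simp add: strict_mono_Suc_iff)
qed

text \<open>Division with remainder by a Groebner basis: \<open>B\<close> lifts generators of the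
  leading ideals at the finitely many points of a dominating set, and subtracting a suitable
  combination of shifted basis elements lowers the leading key. Generation is expressed through
  closed sets \<open>N\<close>, which avoids naming the ring acting on \<open>M\<close>. Closure is
  demanded only for elements of \<open>M\<close>, so that a user may exploit the properties of
  \<open>M\<close> when checking it.\<close>

lemma finitely_generated:
  obtains B where "finite B" "B \<subseteq> M"
    "\<And>N. \<lbrakk>B \<subseteq> N; (\<lambda>x. \<zero>) \<in> N;
      \<And>u v. \<lbrakk>u \<in> N; v \<in> N; u \<in> M; v \<in> M\<rbrakk> \<Longrightarrow> (\<lambda>x. u x \<oplus> v x) \<in> N;
      \<And>r v. \<lbrakk>r \<in> carrier R; v \<in> N; v \<in> M\<rbrakk> \<Longrightarrow> (\<lambda>x. r \<otimes> v x) \<in> N;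
      \<And>t v. \<lbrakk>t \<in> T; v \<in> N; v \<in> M\<rbrakk> \<Longrightarrow> t v \<in> N\<rbrakk> \<Longrightarrow> M \<subseteq> N"
proof -
  obtain F where F: "finite F" "F \<subseteq> X"
    "\<And>x. x \<in> X \<Longrightarrow> \<exists>b\<in>F. dominated b x \<and> lead_coeffs M b = lead_coeffs M x"
    using finite_dominating_set by blast
  \<comment> \<open>Each generator of the leading ideal is by definition the coefficient at
    \<open>b\<close> of a vector bounded by \<open>b\<close>; \<open>G\<close> consists of such
    lifts.\<close>
  have "\<exists>G. finite G \<and> G \<subseteq> M \<and> (\<forall>g\<in>G. bounded g b) \<and> lead_coeffs M b = Idl ((\<lambda>g. g b) ` G)" for b
  proof -
    obtain C where C: "C \<subseteq> carrier R" "finite C" "lead_coeffs M b = Idl C"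
      using finetely_gen lead_coeffs_M_ideal by blast
    then have "C \<subseteq> (\<lambda>g. g b) ` {g \<in> M. bounded g b}"
      using genideal_self[of C] by (auto simp: lead_coeffs_def)
    then show ?thesis
      using C finite_subset_image[OF C(2)] by (smt (verit) mem_Collect_eq subset_iff)
  qed
  then obtain G where G: "\<And>b. finite (G b)" "\<And>b. G b \<subseteq> M" "\<And>b g. g \<in> G b \<Longrightarrow> bounded g b"
    "\<And>b. lead_coeffs M b = Idl ((\<lambda>g. g b) ` G b)"
    by metis
  show thesis
  proof (rule that)
    show "finite (\<Union>b\<in>F. G b)" "(\<Union>b\<in>F. G b) \<subseteq> M"
      using F(1) G(1,2) by auto
  next
    fix N
    assume N: "(\<Union>b\<in>F. G b) \<subseteq> N" "(\<lambda>x. \<zero>) \<in> N"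
      "\<And>u v. \<lbrakk>u \<in> N; v \<in> N; u \<in> M; v \<in> M\<rbrakk> \<Longrightarrow> (\<lambda>x. u x \<oplus> v x) \<in> N"
      "\<And>r v. \<lbrakk>r \<in> carrier R; v \<in> N; v \<in> M\<rbrakk> \<Longrightarrow> (\<lambda>x. r \<otimes> v x) \<in> N"
      "\<And>t v. \<lbrakk>t \<in> T; v \<in> N; v \<in> M\<rbrakk> \<Longrightarrow> t v \<in> N"
    \<comment> \<open>Leading coefficients of \<open>M\<close> are already attained in
      \<open>N\<close>: at the dominating point \<open>b\<close> the ideal is generated by
      \<open>G b\<close>, and a shift from \<open>T\<close> moves the vector found there to
      \<open>x\<close>.\<close>
    have lead: "\<exists>u\<in>N \<inter> M. bounded u x \<and> u x = v x" if v: "v \<in> M" "bounded v x" and x: "x \<in> X" for v x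
    proof -
      obtain b where b: "b \<in> F" "dominated b x" "lead_coeffs M b = lead_coeffs M x"
        using F(3) x by blast
      have "ideal (lead_coeffs (N \<inter> M) b) R"
        using N M_zero M_add M_smult by (intro lead_coeffs_ideal) auto
      moreover have "(\<lambda>g. g b) ` G b \<subseteq> lead_coeffs (N \<inter> M) b"
        using G(2,3) N(1) b(1) unfolding lead_coeffs_def by blast
      ultimately have "lead_coeffs M b \<subseteq> lead_coeffs (N \<inter> M) b"
        using G(4) genideal_minimal by metis
      moreover have "v x \<in> lead_coeffs M b"
        using v b(3) by (auto simp: lead_coeffs_def)
      ultimately obtain w where w: "w \<in> N" "w \<in> M" "bounded w b" "w b = v x"
        by (auto simp: lead_coeffs_def)
      obtain t where t: "t \<in> T" "\<And>v. \<lbrakk>v \<in> M; bounded v b\<rbrakk> \<Longrightarrow> bounded (t v) x \<and> t v x = v b"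
        using b(2) by (auto simp: dominated_def)
      show ?thesis
        using t w N(5)[OF t(1) w(1,2)] M_T[OF t(1) w(2)] by (intro bexI[of _ "t w"]) auto
    qed
    have "v \<in> N" if "v \<in> M" "\<forall>y. v y \<noteq> \<zero> \<longrightarrow> key y \<le> w" for v w
      using that
    proof (induction w arbitrary: v rule: less_induct)
      case (less w)
      \<comment> \<open>The largest key in the support is a bound smaller than \<open>w\<close>, to
        which the induction hypothesis applies. An empty support has no maximum and is treated
        apart.\<close>
      have reduce: "u \<in> N" if u: "u \<in> M" "\<forall>y. u y \<noteq> \<zero> \<longrightarrow> key y < w" for u
      proof (cases "{x. u x \<noteq> \<zero>} = {}")
        case True
        then have "u = (\<lambda>x. \<zero>)" by auto
        then show ?thesis using N(2) by simp
      next
        case False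
        have "finite (key ` {x. u x \<noteq> \<zero>})"
          using M_finite u(1) by simp
        moreover from this have "Max (key ` {x. u x \<noteq> \<zero>}) < w"
          using False u(2) by (subst Max_less_iff) auto
        ultimately show ?thesis
          using less.IH u(1) by (metis (mono_tags, lifting) Max_ge image_eqI mem_Collect_eq)
      qed
      show ?case
      proof (cases "\<exists>x. v x \<noteq> \<zero> \<and> key x = w")
        case False
        then show ?thesis
          using reduce less.prems by (metis order_le_less)
      next
        case True
        then obtain x where x: "v x \<noteq> \<zero>" "key x = w" by blast
        then have "x \<in> X" "bounded v x"
          using M_support less.prems by (auto simp: bounded_def)
        then obtain u where u: "u \<in> N" "u \<in> M" "bounded u x" "u x = v x"
          using lead less.prems(1) by blast
        note carr = M_carrier[OF u(2)] M_carrier[OF less.prems(1)]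
        \<comment> \<open>The subtraction cancels the coefficient at \<open>x\<close>. By
          injectivity of \<open>key\<close>, no other point of \<open>X\<close> has key
          \<open>w\<close>, so all keys left in \<open>d\<close> are smaller.\<close>
        define d where "d = (\<lambda>y. v y \<oplus> \<ominus> \<one> \<otimes> u y)"
        have dM: "d \<in> M"
          unfolding d_def using less.prems(1) u(2) by (intro M_add M_smult) auto
        have "key y < w" if "d y \<noteq> \<zero>" for y
        proof -
          have "v y \<noteq> \<zero> \<or> u y \<noteq> \<zero>"
            using that by (auto simp: d_def)
          then have "key y \<le> w"
            using less.prems(2) u(3) x(2) by (auto simp: bounded_def)
          moreover have "y \<noteq> x"
            using that u(4) carr by (auto simp: d_def l_minus r_neg)
          then have "key y \<noteq> w"
            using inj_key x(2) \<open>x \<in> X\<close> M_support[OF dM that] by (metis inj_onD)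
          ultimately show ?thesis by simp
        qed
        then have "d \<in> N"
          using reduce dM by blast
        moreover have "v = (\<lambda>y. d y \<oplus> u y)"
          using carr by (auto simp: d_def l_minus a_assoc l_neg)
        ultimately show ?thesis
          using N(3) u(1,2) dM by metis
      qed
    qed
    moreover have "\<exists>w. \<forall>y. v y \<noteq> \<zero> \<longrightarrow> key y \<le> w" if "v \<in> M" for v
      using M_finite[OF that] by (intro exI[of _ "Max (key ` {x. v x \<noteq> \<zero>})"]) auto
    ultimately show "M \<subseteq> N" by blast
  qed
qed

end

section \<open>Monoid algebras\<close>

lemma (in abelian_monoid) finsum_swap:
  assumes "finite A" "finite B" "\<And>a b. \<lbrakk>a \<in> A; b \<in> B\<rbrakk> \<Longrightarrow> f a b \<in> carrier G"
  shows "(\<Oplus>a\<in>A. \<Oplus>b\<in>B. f a b) = (\<Oplus>b\<in>B. \<Oplus>a\<in>A. f a b)"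
  using assms
proof (induction A)
  case empty
  then show ?case by simp
next
  case (insert x A)
  then have "(\<Oplus>a\<in>insert x A. \<Oplus>b\<in>B. f a b) = (\<Oplus>b\<in>B. f x b) \<oplus> (\<Oplus>b\<in>B. \<Oplus>a\<in>A. f a b)"
    by (subst finsum_insert) auto
  also have "\<dots> = (\<Oplus>b\<in>B. f x b \<oplus> (\<Oplus>a\<in>A. f a b))"
    using insert.prems insert.hyps by (intro finsum_addf[symmetric]) auto
  also have "\<dots> = (\<Oplus>b\<in>B. \<Oplus>a\<in>insert x A. f a b)"
    using insert.prems insert.hyps by (intro finsum_cong' refl) auto
  finally show ?case .
qed

text \<open>Exponents range over a group containing \<open>E\<close>, so that a product is the convolution
  \<open>\<Sum>\<^sub>a p a \<cdot> q (c - a)\<close>: the coefficient \<open>q (c - a)\<close> is zero when \<open>c - a\<close> is not in \<open>E\<close>.\<close>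

definition monoid_algebra ::
  "('a, 'm) ring_scheme \<Rightarrow> 'e::{plus, zero} set \<Rightarrow> ('e \<Rightarrow> 'a) ring"
  where "monoid_algebra R E = \<lparr>
    carrier = {p. (\<forall>c. p c \<in> carrier R) \<and> finite {c. p c \<noteq> \<zero>\<^bsub>R\<^esub>} \<and> {c. p c \<noteq> \<zero>\<^bsub>R\<^esub>} \<subseteq> E},
    monoid.mult = (\<lambda>p q c. finsum R (\<lambda>(a, b). p a \<otimes>\<^bsub>R\<^esub> q b)
              {(a, b). p a \<noteq> \<zero>\<^bsub>R\<^esub> \<and> q b \<noteq> \<zero>\<^bsub>R\<^esub> \<and> a + b = c}),
    one = (\<lambda>c. if c = 0 then \<one>\<^bsub>R\<^esub> else \<zero>\<^bsub>R\<^esub>),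
    ring.zero = (\<lambda>c. \<zero>\<^bsub>R\<^esub>),
    add = (\<lambda>p q c. p c \<oplus>\<^bsub>R\<^esub> q c)\<rparr>"

lemma monoid_algebra_simps:
  "carrier (monoid_algebra R E) =
    {p. (\<forall>c. p c \<in> carrier R) \<and> finite {c. p c \<noteq> \<zero>\<^bsub>R\<^esub>} \<and> {c. p c \<noteq> \<zero>\<^bsub>R\<^esub>} \<subseteq> E}"
  "(p \<oplus>\<^bsub>monoid_algebra R E\<^esub> q) c = p c \<oplus>\<^bsub>R\<^esub> q c"
  "\<zero>\<^bsub>monoid_algebra R E\<^esub> c = \<zero>\<^bsub>R\<^esub>"
  "\<one>\<^bsub>monoid_algebra R E\<^esub> c = (if c = 0 then \<one>\<^bsub>R\<^esub> else \<zero>\<^bsub>R\<^esub>)"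
  "(p \<otimes>\<^bsub>monoid_algebra R E\<^esub> q) c = finsum R (\<lambda>(a, b). p a \<otimes>\<^bsub>R\<^esub> q b)
    {(a, b). p a \<noteq> \<zero>\<^bsub>R\<^esub> \<and> q b \<noteq> \<zero>\<^bsub>R\<^esub> \<and> a + b = c}"
  by (simp_all add: monoid_algebra_def)

lemma rat_poly_ring_eq: "rat_poly_ring R n = monoid_algebra R (rat_exponents n)"
  by (simp add: rat_poly_ring_def monoid_algebra_def plus_fun_def zero_fun_def)

section \<open>Ring axioms for the convolution product\<close>

locale monoid_algebra_ring = cring R for R (structure) +
  fixes E :: "'e::ab_group_add set" and A :: "('e \<Rightarrow> 'a) ring"
  defines "A \<equiv> monoid_algebra R E"
  assumes zero_exponent: "0 \<in> E"
    and add_exponent: "\<lbrakk>a \<in> E; b \<in> E\<rbrakk> \<Longrightarrow> a + b \<in> E"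
begin

lemma carrier_iff:
  "p \<in> carrier A \<longleftrightarrow> (\<forall>c. p c \<in> carrier R) \<and> finite {c. p c \<noteq> \<zero>} \<and> (\<forall>c. p c \<noteq> \<zero> \<longrightarrow> c \<in> E)"
  by (auto simp: A_def monoid_algebra_simps)

lemma coeff_closed [simp]: "p \<in> carrier A \<Longrightarrow> p c \<in> carrier R"
  by (simp add: carrier_iff)

lemma finite_support: "p \<in> carrier A \<Longrightarrow> finite {c. p c \<noteq> \<zero>}"
  by (simp add: carrier_iff)

lemma add_apply: "(p \<oplus>\<^bsub>A\<^esub> q) c = p c \<oplus> q c"
  by (simp add: A_def monoid_algebra_simps)

lemma zero_apply: "\<zero>\<^bsub>A\<^esub> c = \<zero>"
  by (simp add: A_def monoid_algebra_simps)

lemma one_apply: "\<one>\<^bsub>A\<^esub> c = (if c = 0 then \<one> else \<zero>)"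
  by (simp add: A_def monoid_algebra_simps)

text \<open>A pair with sum \<open>c\<close> is determined by its first component. Any finite
  \<open>P\<close> containing the support of \<open>p\<close> is allowed, so that several products
  can be summed over one index set, as distributivity and associativity require.\<close>

lemma mult_apply:
  assumes pq: "p \<in> carrier A" "q \<in> carrier A"
    and P: "finite P" "\<And>a. p a \<noteq> \<zero> \<Longrightarrow> a \<in> P"
  shows "(p \<otimes>\<^bsub>A\<^esub> q) c = (\<Oplus>a\<in>P. p a \<otimes> q (c - a))"
proof -
  let ?S = "{a. p a \<noteq> \<zero> \<and> q (c - a) \<noteq> \<zero>}"
  have "{(a, b). p a \<noteq> \<zero> \<and> q b \<noteq> \<zero> \<and> a + b = c} = (\<lambda>a. (a, c - a)) ` ?S"
    by (auto simp: image_iff)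
  then have "(p \<otimes>\<^bsub>A\<^esub> q) c = finsum R (\<lambda>(a, b). p a \<otimes> q b) ((\<lambda>a. (a, c - a)) ` ?S)"
    by (simp add: A_def monoid_algebra_simps)
  also have "\<dots> = (\<Oplus>a\<in>?S. p a \<otimes> q (c - a))"
    using pq by (subst finsum_reindex) (auto simp: inj_on_def)
  also have "\<dots> = (\<Oplus>a\<in>P. p a \<otimes> q (c - a))"
  proof (rule add.finprod_mono_neutral_cong_left)
    fix a assume "a \<in> P - ?S"
    then have "p a = \<zero> \<or> q (c - a) = \<zero>" by blast
    then show "p a \<otimes> q (c - a) = \<zero>" using pq by auto
  qed (use pq P in auto)
  finally show ?thesis .
qed

lemma mult_commute:
  assumes pq: "p \<in> carrier A" "q \<in> carrier A"
  shows "p \<otimes>\<^bsub>A\<^esub> q = q \<otimes>\<^bsub>A\<^esub> p"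
proof
  fix c
  let ?S = "{(a, b). p a \<noteq> \<zero> \<and> q b \<noteq> \<zero> \<and> a + b = c}"
  have "{(a, b). q a \<noteq> \<zero> \<and> p b \<noteq> \<zero> \<and> a + b = c} = prod.swap ` ?S"
    by (auto simp: image_iff add.commute)
  then have "(q \<otimes>\<^bsub>A\<^esub> p) c = finsum R (\<lambda>(a, b). q a \<otimes> p b) (prod.swap ` ?S)"
    by (simp add: A_def monoid_algebra_simps)
  also have "\<dots> = finsum R (\<lambda>x. case prod.swap x of (a, b) \<Rightarrow> q a \<otimes> p b) ?S"
    using pq by (subst finsum_reindex) (auto simp: inj_on_def)
  also have "\<dots> = finsum R (\<lambda>(a, b). p a \<otimes> q b) ?S"
    using pq by (intro finsum_cong' refl) (auto simp: m_comm)
  finally show "(p \<otimes>\<^bsub>A\<^esub> q) c = (q \<otimes>\<^bsub>A\<^esub> p) c"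
    by (simp add: A_def monoid_algebra_simps)
qed

lemma mult_closed:
  assumes pq: "p \<in> carrier A" "q \<in> carrier A"
  shows "p \<otimes>\<^bsub>A\<^esub> q \<in> carrier A"
proof -
  let ?P = "{c. p c \<noteq> \<zero>}" and ?Q = "{c. q c \<noteq> \<zero>}"
  note mult = mult_apply[OF pq finite_support[OF pq(1)]]
  have "\<exists>a\<in>?P. c - a \<in> ?Q" if "(p \<otimes>\<^bsub>A\<^esub> q) c \<noteq> \<zero>" for c
  proof (rule ccontr)
    assume "\<not> ?thesis"
    then have "(\<Oplus>a\<in>?P. p a \<otimes> q (c - a)) = (\<Oplus>a\<in>?P. \<zero>)"
      using pq by (intro finsum_cong' refl) auto
    then show False using that mult by simp
  qed
  then have supp: "{c. (p \<otimes>\<^bsub>A\<^esub> q) c \<noteq> \<zero>} \<subseteq> (\<lambda>(a, b). a + b) ` (?P \<times> ?Q)"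
    by (force simp: image_iff)
  have "(p \<otimes>\<^bsub>A\<^esub> q) c \<in> carrier R" for c
    using mult pq by (simp add: finsum_closed)
  moreover have "finite {c. (p \<otimes>\<^bsub>A\<^esub> q) c \<noteq> \<zero>}"
    using supp pq finite_support by (meson finite_SigmaI finite_imageI finite_subset)
  moreover have "(\<lambda>(a, b). a + b) ` (?P \<times> ?Q) \<subseteq> E"
    using pq add_exponent by (auto simp: carrier_iff)
  ultimately show ?thesis
    using supp by (auto simp: carrier_iff)
qed

lemma mult_assoc:
  assumes pqr: "p \<in> carrier A" "q \<in> carrier A" "r \<in> carrier A"
  shows "(p \<otimes>\<^bsub>A\<^esub> q) \<otimes>\<^bsub>A\<^esub> r = p \<otimes>\<^bsub>A\<^esub> (q \<otimes>\<^bsub>A\<^esub> r)"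
proof
  fix c
  let ?P = "{c. p c \<noteq> \<zero>}" and ?Q = "{c. q c \<noteq> \<zero>}"
  \<comment> \<open>\<open>?D\<close> contains the support of the product, as
    \<open>mult_apply\<close> demands, and also every translate of \<open>?Q\<close> by an element
    of \<open>?P\<close>, even where cancellation makes the product vanish. This allows the inner
    sum to be reindexed after the swap.\<close>
  let ?D = "{c. (p \<otimes>\<^bsub>A\<^esub> q) c \<noteq> \<zero>} \<union> (\<lambda>(a, b). a + b) ` (?P \<times> ?Q)"
  note pq = mult_closed[OF pqr(1,2)] and qr = mult_closed[OF pqr(2,3)]
  note fin = finite_support[OF pqr(1)] finite_support[OF pqr(2)]
  have D: "finite ?D" using fin finite_support[OF pq] by simp
  have "((p \<otimes>\<^bsub>A\<^esub> q) \<otimes>\<^bsub>A\<^esub> r) c = (\<Oplus>b\<in>?D. (p \<otimes>\<^bsub>A\<^esub> q) b \<otimes> r (c - b))"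
    by (rule mult_apply[OF pq pqr(3) D]) auto
  also have "\<dots> = (\<Oplus>b\<in>?D. \<Oplus>a\<in>?P. p a \<otimes> q (b - a) \<otimes> r (c - b))"
  proof (intro finsum_cong' refl)
    fix b
    show "(p \<otimes>\<^bsub>A\<^esub> q) b \<otimes> r (c - b) = (\<Oplus>a\<in>?P. p a \<otimes> q (b - a) \<otimes> r (c - b))"
      using pqr fin by (subst mult_apply[OF pqr(1,2) fin(1)]) (auto simp: finsum_ldistr)
  qed (use pqr in \<open>auto intro!: finsum_closed\<close>)
  also have "\<dots> = (\<Oplus>a\<in>?P. \<Oplus>b\<in>?D. p a \<otimes> q (b - a) \<otimes> r (c - b))"
    using pqr fin(1) D by (intro finsum_swap) auto
  also have "\<dots> = (\<Oplus>a\<in>?P. p a \<otimes> (q \<otimes>\<^bsub>A\<^esub> r) (c - a))"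
  proof (intro finsum_cong' refl)
    fix a assume a: "a \<in> ?P"
    have "(\<Oplus>b\<in>?D. p a \<otimes> q (b - a) \<otimes> r (c - b))
      = (\<Oplus>b\<in>(\<lambda>b. a + b) ` ?Q. p a \<otimes> q (b - a) \<otimes> r (c - b))"
      using a D pqr
    proof (intro add.finprod_mono_neutral_cong_right)
      fix b assume "b \<in> ?D - (\<lambda>b. a + b) ` ?Q"
      then have "q (b - a) = \<zero>"
        by (auto simp: image_iff)
      then show "p a \<otimes> q (b - a) \<otimes> r (c - b) = \<zero>"
        using pqr by simp
    qed auto
    also have "\<dots> = (\<Oplus>b\<in>?Q. p a \<otimes> q b \<otimes> r (c - (a + b)))"
      using pqr by (subst finsum_reindex) auto
    also have "\<dots> = (\<Oplus>b\<in>?Q. p a \<otimes> (q b \<otimes> r (c - a - b)))"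
      using pqr by (intro finsum_cong' refl) (auto simp: m_assoc diff_diff_add)
    also have "\<dots> = p a \<otimes> (\<Oplus>b\<in>?Q. q b \<otimes> r (c - a - b))"
      using pqr fin by (intro finsum_rdistr[symmetric]) auto
    also have "(\<Oplus>b\<in>?Q. q b \<otimes> r (c - a - b)) = (q \<otimes>\<^bsub>A\<^esub> r) (c - a)"
      by (rule mult_apply[OF pqr(2,3) fin(2), symmetric]) auto
    finally show "(\<Oplus>b\<in>?D. p a \<otimes> q (b - a) \<otimes> r (c - b)) = p a \<otimes> (q \<otimes>\<^bsub>A\<^esub> r) (c - a)" .
  qed (use pqr qr in auto)
  also have "\<dots> = (p \<otimes>\<^bsub>A\<^esub> (q \<otimes>\<^bsub>A\<^esub> r)) c"
    by (rule mult_apply[OF pqr(1) qr fin(1), symmetric]) auto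
  finally show "((p \<otimes>\<^bsub>A\<^esub> q) \<otimes>\<^bsub>A\<^esub> r) c = (p \<otimes>\<^bsub>A\<^esub> (q \<otimes>\<^bsub>A\<^esub> r)) c" .
qed

lemma add_closed:
  assumes pq: "p \<in> carrier A" "q \<in> carrier A"
  shows "p \<oplus>\<^bsub>A\<^esub> q \<in> carrier A"
proof -
  have supp: "p c \<noteq> \<zero> \<or> q c \<noteq> \<zero>" if "p c \<oplus> q c \<noteq> \<zero>" for c
    using that by auto
  then have "finite {c. p c \<oplus> q c \<noteq> \<zero>}"
    by (intro finite_subset[OF _ finite_UnI[OF pq[THEN finite_support]]] subsetI) simp
  moreover have "c \<in> E" if "p c \<oplus> q c \<noteq> \<zero>" for c
    using supp[OF that] pq by (auto simp: carrier_iff)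
  ultimately show ?thesis
    using pq by (simp add: carrier_iff add_apply)
qed

definition monom :: "'a \<Rightarrow> 'e \<Rightarrow> 'e \<Rightarrow> 'a"
  where "monom r a = (\<lambda>c. if c = a then r else \<zero>)"

lemma monom_closed: "\<lbrakk>r \<in> carrier R; a \<in> E\<rbrakk> \<Longrightarrow> monom r a \<in> carrier A"
  by (auto simp: carrier_iff monom_def intro: finite_subset[of _ "{a}"])

lemma monom_mult_apply:
  assumes "r \<in> carrier R" "a \<in> E" "p \<in> carrier A"
  shows "(monom r a \<otimes>\<^bsub>A\<^esub> p) c = r \<otimes> p (c - a)"
proof -
  have "(monom r a \<otimes>\<^bsub>A\<^esub> p) c = (\<Oplus>b\<in>{a}. monom r a b \<otimes> p (c - b))"
    using assms by (intro mult_apply monom_closed) (auto simp: monom_def split: if_splits)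
  then show ?thesis
    using assms by (simp add: monom_def)
qed

lemma one_eq_monom: "\<one>\<^bsub>A\<^esub> = monom \<one> 0"
  by (auto simp: one_apply monom_def)

lemma cring_A: "cring A"
proof (rule cringI)
  show "abelian_group A"
  proof (rule abelian_groupI)
    show "\<zero>\<^bsub>A\<^esub> \<in> carrier A"
      by (simp add: carrier_iff zero_apply)
    fix p assume p: "p \<in> carrier A"
    show "\<zero>\<^bsub>A\<^esub> \<oplus>\<^bsub>A\<^esub> p = p"
      using p by (auto simp: add_apply zero_apply)
    have "(\<ominus> p c = \<zero>) = (p c = \<zero>)" for c
      using p by simp
    then have "(\<lambda>c. \<ominus> p c) \<in> carrier A"
      using p by (simp add: carrier_iff)
    then show "\<exists>q\<in>carrier A. q \<oplus>\<^bsub>A\<^esub> p = \<zero>\<^bsub>A\<^esub>"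
      using p by (intro bexI[of _ "\<lambda>c. \<ominus> p c"]) (auto simp: fun_eq_iff add_apply zero_apply l_neg)
  qed (auto simp: fun_eq_iff add_apply add_closed a_ac)
  show "comm_monoid A"
  proof (rule comm_monoidI)
    show "\<one>\<^bsub>A\<^esub> \<in> carrier A"
      by (simp add: one_eq_monom monom_closed zero_exponent)
    show "\<one>\<^bsub>A\<^esub> \<otimes>\<^bsub>A\<^esub> p = p" if "p \<in> carrier A" for p
      using that by (auto simp: one_eq_monom monom_mult_apply zero_exponent)
  qed (simp add: mult_closed, simp add: mult_assoc, rule mult_commute)
  fix p q r assume pqr: "p \<in> carrier A" "q \<in> carrier A" "r \<in> carrier A"
  let ?P = "{c. p c \<noteq> \<zero>} \<union> {c. q c \<noteq> \<zero>}"
  have P: "finite ?P" using pqr finite_support by simp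
  show "(p \<oplus>\<^bsub>A\<^esub> q) \<otimes>\<^bsub>A\<^esub> r = p \<otimes>\<^bsub>A\<^esub> r \<oplus>\<^bsub>A\<^esub> q \<otimes>\<^bsub>A\<^esub> r"
  proof
    fix c
    have "((p \<oplus>\<^bsub>A\<^esub> q) \<otimes>\<^bsub>A\<^esub> r) c = (\<Oplus>a\<in>?P. (p \<oplus>\<^bsub>A\<^esub> q) a \<otimes> r (c - a))"
      using pqr by (intro mult_apply add_closed P) (auto simp: add_apply)
    also have "\<dots> = (\<Oplus>a\<in>?P. p a \<otimes> r (c - a) \<oplus> q a \<otimes> r (c - a))"
      using pqr by (intro finsum_cong' refl) (auto simp: add_apply l_distr)
    also have "\<dots> = (\<Oplus>a\<in>?P. p a \<otimes> r (c - a)) \<oplus> (\<Oplus>a\<in>?P. q a \<otimes> r (c - a))"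
      using pqr by (intro finsum_addf) auto
    also have "(\<Oplus>a\<in>?P. p a \<otimes> r (c - a)) = (p \<otimes>\<^bsub>A\<^esub> r) c"
      using pqr by (intro mult_apply[symmetric] P) auto
    also have "(\<Oplus>a\<in>?P. q a \<otimes> r (c - a)) = (q \<otimes>\<^bsub>A\<^esub> r) c"
      using pqr by (intro mult_apply[symmetric] P) auto
    finally show "((p \<oplus>\<^bsub>A\<^esub> q) \<otimes>\<^bsub>A\<^esub> r) c = (p \<otimes>\<^bsub>A\<^esub> r \<oplus>\<^bsub>A\<^esub> q \<otimes>\<^bsub>A\<^esub> r) c"
      by (simp only: add_apply[of "p \<otimes>\<^bsub>A\<^esub> r" "q \<otimes>\<^bsub>A\<^esub> r" c])
  qed
qed

lemma finsum_apply:
  assumes "finite I" "\<And>i. i \<in> I \<Longrightarrow> f i \<in> carrier A"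
  shows "(\<Oplus>\<^bsub>A\<^esub>i\<in>I. f i) c = (\<Oplus>i\<in>I. f i c)"
proof -
  interpret A: cring A by (rule cring_A)
  show ?thesis
    using assms
  proof (induction I)
    case (insert x I)
    then show ?case
      by (subst A.finsum_insert) (auto simp: add_apply)
  qed (simp add: zero_apply)
qed

end

section \<open>Finite presentation of ideals\<close>

lemma free_module_simps:
  "carrier (free_module R k) = {..<k} \<rightarrow>\<^sub>E carrier R"
  "\<zero>\<^bsub>free_module R k\<^esub> = (\<lambda>i\<in>{..<k}. \<zero>\<^bsub>R\<^esub>)"
  "v \<oplus>\<^bsub>free_module R k\<^esub> w = (\<lambda>i\<in>{..<k}. v i \<oplus>\<^bsub>R\<^esub> w i)"
  "r \<odot>\<^bsub>free_module R k\<^esub> v = (\<lambda>i\<in>{..<k}. r \<otimes>\<^bsub>R\<^esub> v i)"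
  by (simp_all add: free_module_def)

lemma free_module_eqI:
  assumes "v \<in> carrier (free_module R k)" "w \<in> carrier (free_module R k)"
    and "\<And>i. i < k \<Longrightarrow> v i = w i"
  shows "v = w"
  using assms by (intro PiE_ext[of v "{..<k}" "\<lambda>_. carrier R" w]) (auto simp: free_module_simps)

lemma (in cring) free_module_is_module: "module R (free_module R k)"
proof (rule moduleI)
  show "abelian_group (free_module R k)"
  proof (rule abelian_groupI)
    fix v assume v: "v \<in> carrier (free_module R k)"
    show "\<zero>\<^bsub>free_module R k\<^esub> \<oplus>\<^bsub>free_module R k\<^esub> v = v"
      by (rule free_module_eqI[of _ R k]) (use v in \<open>auto simp: free_module_simps PiE_def Pi_def\<close>)
    show "\<exists>w\<in>carrier (free_module R k). w \<oplus>\<^bsub>free_module R k\<^esub> v = \<zero>\<^bsub>free_module R k\<^esub>"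
      using v by (intro bexI[of _ "\<lambda>i\<in>{..<k}. \<ominus> v i"])
        (auto simp: free_module_simps PiE_def Pi_def l_neg cong: restrict_cong)
  qed (auto simp: free_module_simps PiE_def Pi_def a_ac cong: restrict_cong)
  show "\<one> \<odot>\<^bsub>free_module R k\<^esub> v = v" if "v \<in> carrier (free_module R k)" for v
    by (rule free_module_eqI[of _ R k]) (use that in \<open>auto simp: free_module_simps PiE_def Pi_def\<close>)
qed (auto simp: is_cring free_module_simps PiE_def Pi_def l_distr r_distr m_assoc cong: restrict_cong)

section \<open>Linear combinations as homomorphisms from free modules\<close>

context module
begin

lemma zero_mem_submodule: "submodule N R M \<Longrightarrow> \<zero>\<^bsub>M\<^esub> \<in> N"
  using subgroup.one_closed[of N "add_monoid M"] by (simp add: submodule_def)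

lemma lin_comb_mem_submodule:
  assumes N: "submodule N R M" and "\<And>i. i < (k::nat) \<Longrightarrow> g i \<in> N" "\<And>i. i < k \<Longrightarrow> v i \<in> carrier R"
  shows "(\<Oplus>\<^bsub>M\<^esub>i\<in>{..<k}. v i \<odot>\<^bsub>M\<^esub> g i) \<in> N"
  using assms(2,3)
proof (induction k)
  case 0
  show ?case using zero_mem_submodule[OF N] by simp
next
  case (Suc k)
  have "v i \<odot>\<^bsub>M\<^esub> g i \<in> N" if "i < Suc k" for i
    using Suc.prems that submoduleE(4)[OF N] by blast
  moreover have "v i \<odot>\<^bsub>M\<^esub> g i \<in> carrier M" if "i < Suc k" for i
    using calculation that submoduleE(1)[OF N] by blast
  ultimately show ?case
    using Suc submoduleE(5)[OF N] by (simp add: lessThan_Suc Pi_def)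
qed

lemma lin_comb_hom:
  assumes g: "\<And>i. i < k \<Longrightarrow> g i \<in> carrier M"
  shows "(\<lambda>v. \<Oplus>\<^bsub>M\<^esub>i\<in>{..<k}. v i \<odot>\<^bsub>M\<^esub> g i) \<in> module_homs R (free_module R k) M" (is "?h \<in> _")
proof -
  have closed: "v i \<odot>\<^bsub>M\<^esub> g i \<in> carrier M" if "v \<in> carrier (free_module R k)" "i < k" for v i
    using that g by (auto simp: free_module_simps)
  have "?h (v \<oplus>\<^bsub>free_module R k\<^esub> w) = ?h v \<oplus>\<^bsub>M\<^esub> ?h w"
    if vw: "v \<in> carrier (free_module R k)" "w \<in> carrier (free_module R k)" for v w
  proof -
    have "?h (v \<oplus>\<^bsub>free_module R k\<^esub> w) = (\<Oplus>\<^bsub>M\<^esub>i\<in>{..<k}. v i \<odot>\<^bsub>M\<^esub> g i \<oplus>\<^bsub>M\<^esub> w i \<odot>\<^bsub>M\<^esub> g i)"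
      using vw g closed by (intro M.finsum_cong' refl) (auto simp: free_module_simps PiE_def Pi_def smult_l_distr)
    also have "\<dots> = ?h v \<oplus>\<^bsub>M\<^esub> ?h w"
      using vw closed by (intro M.finsum_addf) auto
    finally show ?thesis .
  qed
  moreover have "?h (r \<odot>\<^bsub>free_module R k\<^esub> v) = r \<odot>\<^bsub>M\<^esub> ?h v"
    if r: "r \<in> carrier R" and v: "v \<in> carrier (free_module R k)" for r v
  proof -
    have "?h (r \<odot>\<^bsub>free_module R k\<^esub> v) = (\<Oplus>\<^bsub>M\<^esub>i\<in>{..<k}. r \<odot>\<^bsub>M\<^esub> (v i \<odot>\<^bsub>M\<^esub> g i))"
      using r v g closed by (intro M.finsum_cong' refl) (auto simp: free_module_simps PiE_def Pi_def smult_assoc1)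
    also have "\<dots> = r \<odot>\<^bsub>M\<^esub> ?h v"
      using r v closed by (intro finsum_smult_ldistr[symmetric]) auto
    finally show ?thesis .
  qed
  moreover have "?h v \<in> carrier M" if "v \<in> carrier (free_module R k)" for v
    using that closed by (intro M.finsum_closed) auto
  ultimately show ?thesis
    by (simp add: module_homs_def)
qed

lemma lin_comb_image_submodule:
  assumes g: "\<And>i. i < k \<Longrightarrow> g i \<in> carrier M"
  defines "I \<equiv> (\<lambda>v. \<Oplus>\<^bsub>M\<^esub>i\<in>{..<k}. v i \<odot>\<^bsub>M\<^esub> g i) ` carrier (free_module R k)"
  shows "submodule I R M" and "\<And>j. j < k \<Longrightarrow> g j \<in> I"
proof -
  interpret F: module R "free_module R k" by (rule free_module_is_module)
  define h where "h = (\<lambda>v. \<Oplus>\<^bsub>M\<^esub>i\<in>{..<k}. v i \<odot>\<^bsub>M\<^esub> g i)"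
  have I: "I = h ` carrier (free_module R k)"
    by (simp add: I_def h_def)
  have h: "\<And>v. v \<in> carrier (free_module R k) \<Longrightarrow> h v \<in> carrier M"
    "\<And>v w. \<lbrakk>v \<in> carrier (free_module R k); w \<in> carrier (free_module R k)\<rbrakk> \<Longrightarrow>
      h (v \<oplus>\<^bsub>free_module R k\<^esub> w) = h v \<oplus>\<^bsub>M\<^esub> h w"
    "\<And>r v. \<lbrakk>r \<in> carrier R; v \<in> carrier (free_module R k)\<rbrakk> \<Longrightarrow>
      h (r \<odot>\<^bsub>free_module R k\<^esub> v) = r \<odot>\<^bsub>M\<^esub> h v"
    using lin_comb_hom[of k g, OF g] by (auto simp: module_homs_def h_def)
  have smult: "r \<odot>\<^bsub>M\<^esub> x \<in> I" if "r \<in> carrier R" "x \<in> I" for r x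
    using that by (auto simp: I h(3)[symmetric])
  show "submodule I R M"
  proof (rule submoduleI)
    show "I \<subseteq> carrier M" using h(1) by (auto simp: I)
    \<comment> \<open>\<open>module_homs\<close> says nothing about zero; it is the multiple of
      itself by the scalar zero.\<close>
    have "h \<zero>\<^bsub>free_module R k\<^esub> = \<zero>\<^bsub>M\<^esub>"
      using h(1) h(3)[of \<zero> "\<zero>\<^bsub>free_module R k\<^esub>"] by simp
    then show "\<zero>\<^bsub>M\<^esub> \<in> I" by (metis F.zero_closed I imageI)
    fix x assume x: "x \<in> I"
    show "\<ominus>\<^bsub>M\<^esub> x \<in> I"
      using smult[of "\<ominus> \<one>" x] x \<open>I \<subseteq> carrier M\<close> by (auto simp: smult_l_minus)
    fix y assume "y \<in> I"
    then show "x \<oplus>\<^bsub>M\<^esub> y \<in> I"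
      using x by (auto simp: I h(2)[symmetric])
  qed (rule smult)
  fix j assume j: "j < k"
  \<comment> \<open>The standard basis vector at \<open>j\<close>, a preimage of
    \<open>g j\<close>.\<close>
  define e where "e = (\<lambda>i\<in>{..<k}. if i = j then \<one> else \<zero>)"
  have "h e = (\<Oplus>\<^bsub>M\<^esub>i\<in>{..<k}. if i = j then g i else \<zero>\<^bsub>M\<^esub>)"
    using g unfolding h_def by (intro M.finsum_cong' refl) (auto simp: e_def)
  also have "\<dots> = g j"
    using g j by (intro M.add.finprod_singleton_swap) auto
  finally show "g j \<in> I"
    unfolding I by (intro image_eqI[of _ _ e]) (auto simp: e_def free_module_simps)
qed

lemma lin_comb_kernel_submodule:
  assumes g: "\<And>i. i < k \<Longrightarrow> g i \<in> carrier M"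
  shows "submodule {v \<in> carrier (free_module R k). (\<Oplus>\<^bsub>M\<^esub>i\<in>{..<k}. v i \<odot>\<^bsub>M\<^esub> g i) = \<zero>\<^bsub>M\<^esub>}
    R (free_module R k)" (is "submodule ?K _ _")
proof -
  interpret F: module R "free_module R k" by (rule free_module_is_module)
  define h where "h = (\<lambda>v. \<Oplus>\<^bsub>M\<^esub>i\<in>{..<k}. v i \<odot>\<^bsub>M\<^esub> g i)"
  have K: "?K = {v \<in> carrier (free_module R k). h v = \<zero>\<^bsub>M\<^esub>}"
    by (simp add: h_def)
  have h: "\<And>v. v \<in> carrier (free_module R k) \<Longrightarrow> h v \<in> carrier M"
    "\<And>v w. \<lbrakk>v \<in> carrier (free_module R k); w \<in> carrier (free_module R k)\<rbrakk> \<Longrightarrow>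
      h (v \<oplus>\<^bsub>free_module R k\<^esub> w) = h v \<oplus>\<^bsub>M\<^esub> h w"
    "\<And>r v. \<lbrakk>r \<in> carrier R; v \<in> carrier (free_module R k)\<rbrakk> \<Longrightarrow>
      h (r \<odot>\<^bsub>free_module R k\<^esub> v) = r \<odot>\<^bsub>M\<^esub> h v"
    using lin_comb_hom[of k g, OF g] by (auto simp: module_homs_def h_def)
  have smult: "r \<odot>\<^bsub>free_module R k\<^esub> v \<in> ?K" if "r \<in> carrier R" "v \<in> ?K" for r v
    using that h(3) by (simp add: K)
  show ?thesis
  proof (rule F.submoduleI)
    show "\<zero>\<^bsub>free_module R k\<^esub> \<in> ?K"
      using h(1) h(3)[of \<zero> "\<zero>\<^bsub>free_module R k\<^esub>"] by (simp add: K)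
    show "\<ominus>\<^bsub>free_module R k\<^esub> v \<in> ?K" if "v \<in> ?K" for v
      using smult[of "\<ominus> \<one>" v] that by (auto simp: K F.smult_l_minus)
    show "v \<oplus>\<^bsub>free_module R k\<^esub> w \<in> ?K" if "v \<in> ?K" "w \<in> ?K" for v w
      using that h(2) by (auto simp: K)
  qed (use smult in auto)
qed

text \<open>Generators and relations are both described by the submodules containing them, so no
  coefficients have to be exhibited. The images of \<open>\<psi>\<close> and \<open>\<phi>\<close>
  are submodules containing \<open>g\<close> and \<open>B\<close> respectively, hence are all of
  \<open>M\<close> and of \<open>K\<close>.\<close>

lemma finitely_presentedI:
  assumes g: "\<And>i. i < k \<Longrightarrow> g i \<in> carrier M"
    and gen: "\<And>N. \<lbrakk>submodule N R M; \<And>i. i < k \<Longrightarrow> g i \<in> N\<rbrakk> \<Longrightarrow> carrier M \<subseteq> N"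
  defines "K \<equiv> {v \<in> carrier (free_module R k). (\<Oplus>\<^bsub>M\<^esub>i\<in>{..<k}. v i \<odot>\<^bsub>M\<^esub> g i) = \<zero>\<^bsub>M\<^esub>}"
  assumes B: "finite B" "B \<subseteq> K"
    and relations: "\<And>N. \<lbrakk>submodule N R (free_module R k); B \<subseteq> N\<rbrakk> \<Longrightarrow> K \<subseteq> N"
  shows "finitely_presented R M"
proof -
  interpret F: module R "free_module R k" by (rule free_module_is_module)
  define \<psi> where "\<psi> = (\<lambda>v. \<Oplus>\<^bsub>M\<^esub>i\<in>{..<k}. v i \<odot>\<^bsub>M\<^esub> g i)"
  obtain m and b :: "nat \<Rightarrow> nat \<Rightarrow> 'a" where b: "B = b ` {..<m}"
    using B(1) by (metis finite_imp_nat_seg_image_inj_on lessThan_def)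
  define \<phi> where "\<phi> = (\<lambda>v. \<Oplus>\<^bsub>free_module R k\<^esub>i\<in>{..<m}. v i \<odot>\<^bsub>free_module R k\<^esub> b i)"
  have bK: "b i \<in> K" "b i \<in> carrier (free_module R k)" if "i < m" for i
    using that b B(2) by (auto simp: K_def)
  have \<psi>: "\<psi> \<in> module_homs R (free_module R k) M"
    unfolding \<psi>_def by (rule lin_comb_hom[OF g])
  have \<phi>: "\<phi> \<in> module_homs R (free_module R m) (free_module R k)"
    unfolding \<phi>_def by (rule F.lin_comb_hom[OF bK(2)])
  have "carrier M \<subseteq> \<psi> ` carrier (free_module R k)"
    unfolding \<psi>_def by (rule gen) (use lin_comb_image_submodule[of k g, OF g] in auto)
  then have surj: "\<psi> ` carrier (free_module R k) = carrier M"
    using \<psi> by (auto simp: module_homs_def)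
  have K: "K = {v \<in> carrier (free_module R k). \<psi> v = \<zero>\<^bsub>M\<^esub>}"
    by (simp add: K_def \<psi>_def)
  have "submodule K R (free_module R k)"
    unfolding K_def by (rule lin_comb_kernel_submodule[OF g])
  then have "\<phi> v \<in> K" if "v \<in> carrier (free_module R m)" for v
    using that bK unfolding \<phi>_def
    by (intro F.lin_comb_mem_submodule) (auto simp: free_module_simps)
  moreover have "K \<subseteq> \<phi> ` carrier (free_module R m)"
    unfolding \<phi>_def
    by (rule relations) (use F.lin_comb_image_submodule[of m b, OF bK(2)] b in auto)
  ultimately have "\<phi> ` carrier (free_module R m) = K" by blast
  then show ?thesis
    unfolding finitely_presented_def using module_axioms \<phi> \<psi> surj K by blast
qed

end

section \<open>Ideals as modules, syzygies and a criterion for coherence\<close>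

context cring
begin

lemma ideal_module_simps:
  "carrier (ideal_module R I) = I"
  "\<zero>\<^bsub>ideal_module R I\<^esub> = \<zero>"
  "v \<oplus>\<^bsub>ideal_module R I\<^esub> w = v \<oplus> w"
  "r \<odot>\<^bsub>ideal_module R I\<^esub> v = r \<otimes> v"
  by (simp_all add: ideal_module_def)

lemma ideal_module_is_module:
  assumes "ideal I R"
  shows "module R (ideal_module R I)"
proof -
  interpret ideal I R by fact
  show ?thesis
  proof (rule moduleI)
    show "abelian_group (ideal_module R I)"
    proof (rule abelian_groupI)
      fix v assume v: "v \<in> carrier (ideal_module R I)"
      then show "\<exists>w\<in>carrier (ideal_module R I). w \<oplus>\<^bsub>ideal_module R I\<^esub> v = \<zero>\<^bsub>ideal_module R I\<^esub>"
        by (intro bexI[of _ "\<ominus> v"]) (auto simp: ideal_module_simps l_neg a_Hcarr)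
    qed (auto simp: ideal_module_simps a_Hcarr a_ac)
  qed (auto simp: ideal_module_simps is_cring I_l_closed a_Hcarr l_distr r_distr m_assoc)
qed

lemma finsum_ideal_module:
  assumes "ideal I R" "finite A" "\<And>i. i \<in> A \<Longrightarrow> f i \<in> I"
  shows "finsum (ideal_module R I) f A = finsum R f A"
proof -
  interpret I: ideal I R by fact
  interpret M: module R "ideal_module R I" by (rule ideal_module_is_module) fact
  show ?thesis
    using assms(2,3)
  proof (induction A)
    case (insert x A)
    then show ?case
      by (subst M.finsum_insert) (auto simp: ideal_module_simps I.a_Hcarr)
  qed (simp add: ideal_module_simps)
qed

text \<open>The sum is formed in the ring, not in an ideal, so that the notion refers to the tuple
  \<open>f\<close> alone.\<close>

definition syzygies :: "nat \<Rightarrow> (nat \<Rightarrow> 'a) \<Rightarrow> (nat \<Rightarrow> 'a) set"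
  where "syzygies k f = {v \<in> carrier (free_module R k). (\<Oplus>i\<in>{..<k}. v i \<otimes> f i) = \<zero>}"

lemma syzygies_eq_kernel:
  assumes I: "ideal I R" and f: "\<And>i. i < k \<Longrightarrow> f i \<in> I"
  shows "syzygies k f = {v \<in> carrier (free_module R k).
    (\<Oplus>\<^bsub>ideal_module R I\<^esub>i\<in>{..<k}. v i \<odot>\<^bsub>ideal_module R I\<^esub> f i) = \<zero>\<^bsub>ideal_module R I\<^esub>}"
proof -
  interpret I: ideal I R by fact
  have "(\<Oplus>\<^bsub>ideal_module R I\<^esub>i\<in>{..<k}. v i \<odot>\<^bsub>ideal_module R I\<^esub> f i) = (\<Oplus>i\<in>{..<k}. v i \<otimes> f i)"
    if "v \<in> carrier (free_module R k)" for v
    using that f I.I_l_closed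
    by (subst finsum_ideal_module[OF I]) (auto simp: ideal_module_simps free_module_simps)
  then show ?thesis
    by (auto simp: syzygies_def ideal_module_simps(2))
qed

lemma syzygies_submodule:
  assumes "f \<in> {..<k} \<rightarrow> carrier R"
  shows "submodule (syzygies k f) R (free_module R k)"
proof -
  \<comment> \<open>The ring is regarded as the module of its unit ideal, which makes the syzygies a
    kernel covered by \<open>lin_comb_kernel_submodule\<close>.\<close>
  interpret M: module R "ideal_module R (carrier R)"
    by (rule ideal_module_is_module[OF oneideal])
  have f: "f i \<in> carrier R" if "i < k" for i
    using assms that by auto
  show ?thesis
    by (subst syzygies_eq_kernel[OF oneideal f], assumption, rule M.lin_comb_kernel_submodule) (simp add: f ideal_module_simps)
qed

text \<open>For a tuple \<open>f\<close> enumerating the generators of an ideal, the kernel of the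
  presentation map onto that ideal is the syzygy module of \<open>f\<close>.\<close>

lemma coherent_ringI:
  assumes syzygies: "\<And>k f. f \<in> {..<k} \<rightarrow> carrier R \<Longrightarrow>
    \<exists>B. finite B \<and> B \<subseteq> syzygies k f \<and>
      (\<forall>N. submodule N R (free_module R k) \<longrightarrow> B \<subseteq> N \<longrightarrow> syzygies k f \<subseteq> N)"
  shows "coherent_ring R"
proof unfold_locales
  fix S assume S: "S \<subseteq> carrier R" "finite S"
  define I where "I = Idl S"
  have I: "ideal I R" unfolding I_def by (rule genideal_ideal) fact
  interpret I: ideal I R by fact
  interpret M: module R "ideal_module R I" by (rule ideal_module_is_module) fact
  obtain k and f :: "nat \<Rightarrow> 'a" where f: "S = f ` {..<k}"
    using S(2) by (metis finite_imp_nat_seg_image_inj_on lessThan_def)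
  have fI: "f i \<in> I" if "i < k" for i
    using that f genideal_self[OF S(1)] by (auto simp: I_def)
  have "f \<in> {..<k} \<rightarrow> carrier R"
    using fI I.a_Hcarr by auto
  from syzygies[OF this] obtain B where B: "finite B" "B \<subseteq> syzygies k f"
    "\<And>N. \<lbrakk>submodule N R (free_module R k); B \<subseteq> N\<rbrakk> \<Longrightarrow> syzygies k f \<subseteq> N"
    by blast
  have eq: "syzygies k f = {v \<in> carrier (free_module R k).
      (\<Oplus>\<^bsub>ideal_module R I\<^esub>i\<in>{..<k}. v i \<odot>\<^bsub>ideal_module R I\<^esub> f i) = \<zero>\<^bsub>ideal_module R I\<^esub>}"
    by (rule syzygies_eq_kernel[OF I fI])
  have "finitely_presented R (ideal_module R I)"
  proof (rule M.finitely_presentedI[OF _ _ B[unfolded eq]])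
    show "f i \<in> carrier (ideal_module R I)" if "i < k" for i
      using that fI by (simp add: ideal_module_simps)
    show "carrier (ideal_module R I) \<subseteq> N"
      if N: "submodule N R (ideal_module R I)" and "\<And>i. i < k \<Longrightarrow> f i \<in> N" for N
    proof -
      note E = M.submoduleE[OF N, unfolded ideal_module_simps]
      have carr: "N \<subseteq> carrier R" using E(1) I.a_subset by blast
      \<comment> \<open>A submodule of the ideal is itself an ideal of the ring, so minimality of
        \<open>Idl S\<close> applies to it.\<close>
      have "ideal N R"
      proof (rule idealI)
        show "subgroup N (add_monoid R)"
        proof (rule add.subgroupI)
          show "\<ominus> a \<in> N" if "a \<in> N" for a
            using E(4)[of "\<ominus> \<one>" a] that carr by (auto simp: l_minus)
        qed (use E carr in auto)
        show "a \<otimes> r \<in> N" if "a \<in> N" "r \<in> carrier R" for a r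
          using E(4)[of r a] that carr m_comm[of a r] by auto
      qed (use E ring_axioms in auto)
      moreover have "S \<subseteq> N"
        using that(2) f by auto
      ultimately show ?thesis
        by (simp add: ideal_module_simps I_def genideal_minimal)
    qed
  qed auto
  then show "finitely_presented R (ideal_module R (Idl S))"
    by (simp add: I_def)
qed

end

section \<open>The exponent lattice, its residue classes and its coordinates\<close>

section \<open>Exponents with bounded denominator\<close>

text \<open>Lists are ordered first by length, which makes the order a well-order. The lists
  compared here have equal length, so the order is lexicographic and invariant under translation.
  This makes \<open>key\<close> compatible with multiplication by monomials.\<close>

lemma map_add_le_map_add:
  fixes f g h :: "'b \<Rightarrow> nat"
  shows "map f xs \<le> map g xs \<Longrightarrow> map (\<lambda>i. f i + h i) xs \<le> map (\<lambda>i. g i + h i) xs"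
  by (induction xs) (auto simp: Cons_le_Cons)

definition denominator_lattice :: "nat \<Rightarrow> (nat \<Rightarrow> rat) set"
  where "denominator_lattice d = {a. \<forall>i. of_nat d * a i \<in> \<int>}"

lemma lattice_add: "\<lbrakk>a \<in> denominator_lattice d; b \<in> denominator_lattice d\<rbrakk> \<Longrightarrow> a + b \<in> denominator_lattice d"
  by (simp add: denominator_lattice_def distrib_left)

lemma lattice_diff: "\<lbrakk>a \<in> denominator_lattice d; b \<in> denominator_lattice d\<rbrakk> \<Longrightarrow> a - b \<in> denominator_lattice d"
  by (simp add: denominator_lattice_def right_diff_distrib)

lemma lattice_zero: "0 \<in> denominator_lattice d"
  by (simp add: denominator_lattice_def)

lemma lattice_diff_iff: "b \<in> denominator_lattice d \<Longrightarrow> a - b \<in> denominator_lattice d \<longleftrightarrow> a \<in> denominator_lattice d"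
  using lattice_add[of "a - b" d b] lattice_diff[of a d b] by auto

lemma rat_common_denominator:
  fixes Q :: "rat set"
  assumes "finite Q"
  shows "\<exists>d>0. \<forall>q\<in>Q. of_nat d * q \<in> \<int>"
  using assms
proof (induction Q)
  case empty
  show ?case by auto
next
  case (insert q Q)
  then obtain d where d: "d > 0" "\<forall>q\<in>Q. of_nat d * q \<in> \<int>" by blast
  obtain a b where ab: "b > 0" "q = of_int a / of_int b"
    by (metis quotient_of_denom_pos quotient_of_div surj_pair)
  have "of_nat (nat b * d) * q = of_int (a * int d)"
    using ab by simp
  then have "of_nat (nat b * d) * q \<in> \<int>"
    by (simp only: Ints_of_int)
  moreover have "of_nat (nat b * d) * r \<in> \<int>" if "r \<in> Q" for r
  proof -
    have "of_nat (nat b) * (of_nat d * r) \<in> \<int>"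
      by (rule Ints_mult[OF Ints_of_nat bspec[OF d(2) that]])
    then show ?thesis by (simp add: mult.assoc)
  qed
  ultimately show ?case
    using d(1) ab(1) by (intro exI[of _ "nat b * d"]) auto
qed

lemma exponents_common_denominator:
  assumes "finite S" "S \<subseteq> rat_exponents n"
  shows "\<exists>d>0. S \<subseteq> denominator_lattice d"
proof -
  obtain d where d: "d > 0" "\<And>q. q \<in> (\<Union>a\<in>S. a ` {..<n}) \<Longrightarrow> of_nat d * q \<in> \<int>"
    using rat_common_denominator[of "\<Union>a\<in>S. a ` {..<n}"] assms(1) by auto
  have "of_nat d * a i \<in> \<int>" if "a \<in> S" for a i
    using d(2)[of "a i"] assms(2) that by (cases "i < n") (auto simp: rat_exponents_def)
  then show ?thesis
    using d(1) by (auto simp: denominator_lattice_def)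
qed

text \<open>For \<open>d > 0\<close> this is the representative of \<open>a\<close> modulo \<Gamma>
  with all entries in [0, 1/d), that is, the exponent of a basis monomial of A over the
  subring.\<close>

definition residue :: "nat \<Rightarrow> (nat \<Rightarrow> rat) \<Rightarrow> nat \<Rightarrow> rat"
  where "residue d a = (\<lambda>i. frac (of_nat d * a i) / of_nat d)"

lemma residue_exponent: "a \<in> rat_exponents n \<Longrightarrow> residue d a \<in> rat_exponents n"
  by (simp add: rat_exponents_def residue_def)

lemma diff_residue_lattice_iff:
  assumes "d > 0"
  shows "a - residue d b \<in> denominator_lattice d \<longleftrightarrow> residue d a = residue d b"
proof -
  have "a - residue d b \<in> denominator_lattice d \<longleftrightarrow> (\<forall>i. of_nat d * a i - frac (of_nat d * b i) \<in> \<int>)"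
    using assms by (simp add: denominator_lattice_def residue_def right_diff_distrib)
  also have "\<dots> \<longleftrightarrow> (\<forall>i. frac (of_nat d * a i) = frac (of_nat d * b i))"
    by (simp add: frac_unique_iff frac_lt_1)
  also have "\<dots> \<longleftrightarrow> residue d a = residue d b"
    using assms by (simp add: residue_def fun_eq_iff)
  finally show ?thesis .
qed

text \<open>Entries of \<open>a\<close> are integral multiples of 1/d and those of the residue are
  below 1/d, so a nonnegative sum forces a nonnegative entry of \<open>a\<close>. Hence splitting
  off a residue monomial never leaves negative exponents.\<close>

lemma lattice_add_residue_exponent:
  assumes d: "d > 0" and a: "a \<in> denominator_lattice d" and b: "b \<in> rat_exponents n"
    and ab: "a + residue d b \<in> rat_exponents n"
  shows "a \<in> rat_exponents n"
proof -
  have "0 \<le> a i" for i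
  proof -
    obtain z where z: "of_nat d * a i = of_int z"
      using a by (auto simp: denominator_lattice_def elim: Ints_cases)
    have "0 \<le> of_nat d * (a i + residue d b i)"
      using ab by (simp add: rat_exponents_def)
    also have "\<dots> = of_int z + frac (of_nat d * b i)"
      using d z by (simp add: distrib_left residue_def)
    also have "\<dots> < of_int (z + 1)"
      by (simp add: frac_lt_1)
    finally have "0 \<le> z"
      by (simp only: of_int_0_less_iff)
    then show ?thesis
      using z d by (metis of_int_0_le_iff of_nat_0_less_iff zero_le_mult_iff not_less)
  qed
  moreover have "a i = 0" if "i \<ge> n" for i
    using ab residue_exponent[OF b, of d] that by (simp add: rat_exponents_def)
  ultimately show ?thesis
    by (simp add: rat_exponents_def)
qed

text \<open>Identifies the nonnegative lattice points with tuples of natural numbers, where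
  Dickson's lemma and the lexicographic well-order are available.\<close>

definition lattice_coord :: "nat \<Rightarrow> (nat \<Rightarrow> rat) \<Rightarrow> nat \<Rightarrow> nat"
  where "lattice_coord d a i = nat \<lfloor>of_nat d * a i\<rfloor>"

lemma of_nat_lattice_coord:
  assumes "a \<in> denominator_lattice d" "a \<in> rat_exponents n"
  shows "of_nat (lattice_coord d a i) = of_nat d * a i"
proof -
  obtain z where z: "of_nat d * a i = of_int z"
    using assms(1) by (auto simp: denominator_lattice_def elim: Ints_cases)
  have "0 \<le> of_nat d * a i"
    using assms(2) by (simp add: rat_exponents_def)
  then have "0 \<le> z"
    by (simp add: z)
  then show ?thesis
    by (simp add: lattice_coord_def z)
qed

lemma lattice_coord_add:
  assumes "a \<in> denominator_lattice d" "a \<in> rat_exponents n" "b \<in> denominator_lattice d" "b \<in> rat_exponents n"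
    and "a + b \<in> rat_exponents n"
  shows "lattice_coord d (a + b) i = lattice_coord d a i + lattice_coord d b i"
proof -
  have "(of_nat (lattice_coord d (a + b) i) :: rat) = of_nat (lattice_coord d a i + lattice_coord d b i)"
    using assms by (simp add: of_nat_lattice_coord lattice_add distrib_left)
  then show ?thesis
    by (simp only: of_nat_eq_iff)
qed

section \<open>Syzygies over the ring of polynomials with rational degree\<close>

locale noetherian_rat_poly = cring R + noetherian_ring R for R (structure) +
  fixes n :: nat and A
  defines "A \<equiv> rat_poly_ring R n"

sublocale noetherian_rat_poly \<subseteq> monoid_algebra_ring R "rat_exponents n" A
proof unfold_locales
  show "A \<equiv> monoid_algebra R (rat_exponents n)"
    by (simp add: A_def rat_poly_ring_eq)
qed (auto simp: rat_exponents_def)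

sublocale noetherian_rat_poly \<subseteq> A: cring A
  by (rule cring_A)

section \<open>Finite generation of the tuples with bounded denominator\<close>

context noetherian_rat_poly
begin

abbreviation "F \<equiv> free_module A"

definition lattice_part :: "nat \<Rightarrow> nat \<Rightarrow> (nat \<Rightarrow> (nat \<Rightarrow> rat) \<Rightarrow> 'a) set \<Rightarrow> (nat \<Rightarrow> (nat \<Rightarrow> rat) \<Rightarrow> 'a) set"
  where "lattice_part d k K = {h \<in> K. \<forall>j<k. \<forall>c. h j c \<noteq> \<zero> \<longrightarrow> c \<in> denominator_lattice d}"

text \<open>The tuples are flattened to families indexed by a component and an exponent, to which
  \<open>leading_terms\<close> applies. The sets \<open>N\<close> are submodules over all of A:
  their closure under constants and under monomials with exponents in \<open>L\<close> is what the
  argument uses.\<close>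

lemma lattice_part_finitely_generated:
  assumes d: "d > 0" and K: "submodule K A (F k)"
  shows "\<exists>B. finite B \<and> B \<subseteq> lattice_part d k K \<and>
    (\<forall>N. submodule N A (F k) \<longrightarrow> B \<subseteq> N \<longrightarrow> lattice_part d k K \<subseteq> N)"
proof -
  interpret F: module A "F k" by (rule A.free_module_is_module)
  note K' = F.submoduleE[OF K]
  define L where "L = denominator_lattice d \<inter> rat_exponents n"
  have L_zero: "0 \<in> L" and L_add: "\<And>a b. a \<in> L \<Longrightarrow> b \<in> L \<Longrightarrow> a + b \<in> L"
    by (auto simp: L_def lattice_zero lattice_add zero_exponent add_exponent)
  define X where "X = {..<k} \<times> L"
  \<comment> \<open>position over term: compare the component first, then the exponents lexicographically\<close>
  define key where "key = (\<lambda>(j, a). j # map (lattice_coord d a) [0..<n])"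
  define shift :: "(nat \<Rightarrow> rat) \<Rightarrow> (nat \<times> (nat \<Rightarrow> rat) \<Rightarrow> 'a) \<Rightarrow> nat \<times> (nat \<Rightarrow> rat) \<Rightarrow> 'a"
    where "shift c u = (\<lambda>(j, a). u (j, a - c))" for c u
  define vec :: "(nat \<times> (nat \<Rightarrow> rat) \<Rightarrow> 'a) \<Rightarrow> nat \<Rightarrow> (nat \<Rightarrow> rat) \<Rightarrow> 'a"
    where "vec u = (\<lambda>j\<in>{..<k}. \<lambda>a. u (j, a))" for u
  \<comment> \<open>The flattened form of \<open>lattice_part d k K\<close>. Under
    \<open>vec\<close>, scalars act as constant monomials and \<open>shift c\<close> as
    multiplication by the monomial with exponent \<open>c\<close>, so closure properties transfer
    from \<open>K\<close>.\<close>
  define M where "M = {u. (\<forall>x. u x \<in> carrier R) \<and> finite {x. u x \<noteq> \<zero>} \<and>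
    (\<forall>x. u x \<noteq> \<zero> \<longrightarrow> x \<in> X) \<and> vec u \<in> K}"
  have vec_closed: "vec u \<in> carrier (F k)" if "u \<in> M" for u
    using that K'(1) by (auto simp: M_def)
  have vec_zero: "vec (\<lambda>x. \<zero>) = \<zero>\<^bsub>F k\<^esub>"
    by (auto simp: vec_def free_module_simps zero_apply fun_eq_iff restrict_def)
  have vec_add: "vec (\<lambda>x. u x \<oplus> v x) = vec u \<oplus>\<^bsub>F k\<^esub> vec v" for u v
    by (auto simp: vec_def free_module_simps add_apply fun_eq_iff restrict_def)
  have vec_smult: "vec (\<lambda>x. r \<otimes> u x) = monom r 0 \<odot>\<^bsub>F k\<^esub> vec u" if "r \<in> carrier R" "u \<in> M" for r u
  proof -
    have "(monom r 0 \<otimes>\<^bsub>A\<^esub> vec u j) a = r \<otimes> u (j, a)" if "j < k" for j a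
      using vec_closed[OF \<open>u \<in> M\<close>] \<open>r \<in> carrier R\<close> that
      by (subst monom_mult_apply) (auto simp: zero_exponent free_module_simps PiE_def Pi_def vec_def)
    then show ?thesis
      by (auto simp: vec_def free_module_simps fun_eq_iff restrict_def)
  qed
  have vec_shift: "vec (shift c u) = monom \<one> c \<odot>\<^bsub>F k\<^esub> vec u" if "c \<in> L" "u \<in> M" for c u
  proof -
    have "(monom \<one> c \<otimes>\<^bsub>A\<^esub> vec u j) a = u (j, a - c)" if "j < k" for j a
      using vec_closed[OF \<open>u \<in> M\<close>] \<open>c \<in> L\<close> \<open>u \<in> M\<close> that
      by (subst monom_mult_apply) (auto simp: L_def M_def free_module_simps PiE_def Pi_def vec_def)
    then show ?thesis
      by (auto simp: vec_def shift_def free_module_simps fun_eq_iff restrict_def)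
  qed
  have coord_add: "lattice_coord d (a + c) i = lattice_coord d a i + lattice_coord d c i"
    if "a \<in> L" "c \<in> L" for a c i
    using that L_add[OF that] by (intro lattice_coord_add) (auto simp: L_def)
  have key_mono: "key (j, a + c) \<le> key (j', a' + c)"
    if "key (j, a) \<le> key (j', a')" "a \<in> L" "a' \<in> L" "c \<in> L" for j j' a a' c
  proof -
    have map_eq: "map (lattice_coord d (b + c)) [0..<n]
      = map (\<lambda>i. lattice_coord d b i + lattice_coord d c i) [0..<n]" if "b \<in> L" for b
      using that \<open>c \<in> L\<close> coord_add by simp
    then show ?thesis
      using that map_add_le_map_add[of "lattice_coord d a" "[0..<n]" "lattice_coord d a'" "lattice_coord d c"]
      by (auto simp: key_def Cons_le_Cons map_eq)
  qed
  have coord_eq: "of_nat (lattice_coord d a i) = of_nat d * a i" if "a \<in> L" for a i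
    using that of_nat_lattice_coord[of a d n i] by (auto simp: L_def)
  \<comment> \<open>The last two arguments spell out \<open>bounded\<close> and
    \<open>dominated\<close> for these data.\<close>
  interpret leading_terms R X key "shift ` L" M
    "\<lambda>v x. \<forall>y. v y \<noteq> \<zero> \<longrightarrow> key y \<le> key x"
    "\<lambda>x y. \<exists>t\<in>shift ` L. \<forall>v\<in>M. (\<forall>y. v y \<noteq> \<zero> \<longrightarrow> key y \<le> key x) \<longrightarrow>
      (\<forall>z. t v z \<noteq> \<zero> \<longrightarrow> key z \<le> key y) \<and> t v y = v x"
  proof unfold_locales
    show "inj_on key X"
    proof (rule inj_onI, clarsimp simp: X_def key_def)
      fix a b assume ab: "a \<in> L" "b \<in> L" "\<forall>i\<in>{0..<n}. lattice_coord d a i = lattice_coord d b i"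
      show "a = b"
      proof
        fix i
        show "a i = b i"
        proof (cases "i < n")
          case True
          then have "of_nat d * a i = of_nat d * b i"
            using ab coord_eq by (metis atLeastLessThan_iff zero_le)
          then show ?thesis using d by simp
        next
          case False
          then show ?thesis using ab by (auto simp: L_def rat_exponents_def)
        qed
      qed
    qed
  next
    show "(\<lambda>x. \<zero>) \<in> M"
      using vec_zero F.zero_mem_submodule[OF K] by (simp add: M_def)
  next
    fix u v assume uv: "u \<in> M" "v \<in> M"
    have supp: "u x \<noteq> \<zero> \<or> v x \<noteq> \<zero>" if "u x \<oplus> v x \<noteq> \<zero>" for x
      using that by auto
    then have "{x. u x \<oplus> v x \<noteq> \<zero>} \<subseteq> {x. u x \<noteq> \<zero>} \<union> {x. v x \<noteq> \<zero>}"
      by blast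
    then have "finite {x. u x \<oplus> v x \<noteq> \<zero>}"
      using uv by (rule_tac finite_subset) (auto simp: M_def)
    moreover have "x \<in> X" if "u x \<oplus> v x \<noteq> \<zero>" for x
      using supp[OF that] uv by (cases x) (auto simp: M_def)
    ultimately show "(\<lambda>x. u x \<oplus> v x) \<in> M"
      using uv K'(5) by (simp add: M_def vec_add)
  next
    fix r u assume r: "r \<in> carrier R" and u: "u \<in> M"
    have supp: "u x \<noteq> \<zero>" if "r \<otimes> u x \<noteq> \<zero>" for x
      using that r by auto
    then have "{x. r \<otimes> u x \<noteq> \<zero>} \<subseteq> {x. u x \<noteq> \<zero>}"
      by blast
    then have "finite {x. r \<otimes> u x \<noteq> \<zero>}"
      using u by (rule_tac finite_subset) (auto simp: M_def)
    moreover have "x \<in> X" if "r \<otimes> u x \<noteq> \<zero>" for x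
      using supp[OF that] u by (cases x) (auto simp: M_def)
    moreover have "vec (\<lambda>x. r \<otimes> u x) \<in> K"
      unfolding vec_smult[OF r u]
      using u K'(4) monom_closed[OF r zero_exponent] by (simp add: M_def)
    ultimately show "(\<lambda>x. r \<otimes> u x) \<in> M"
      using u r by (simp add: M_def)
  next
    fix t u assume "t \<in> shift ` L" and u: "u \<in> M"
    then obtain c where c: "c \<in> L" "t = shift c" by blast
    have supp: "{x. shift c u x \<noteq> \<zero>} = (\<lambda>(j, a). (j, a + c)) ` {x. u x \<noteq> \<zero>}"
      by (force simp: shift_def image_iff)
    have "x \<in> X" if "shift c u x \<noteq> \<zero>" for x
    proof -
      have "x \<in> (\<lambda>(j, a). (j, a + c)) ` {x. u x \<noteq> \<zero>}"
        using that supp by blast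
      then obtain j a where x: "x = (j, a + c)" "u (j, a) \<noteq> \<zero>"
        by auto
      then have "(j, a) \<in> X" using u unfolding M_def by blast
      then show ?thesis using x(1) L_add c(1) by (simp add: X_def)
    qed
    moreover have "finite {x. shift c u x \<noteq> \<zero>}"
      unfolding supp using u by (simp add: M_def)
    moreover have "vec (shift c u) \<in> K"
      unfolding vec_shift[OF c(1) u]
      using u c K'(4) monom_closed[OF one_closed, of c] by (simp add: M_def L_def)
    moreover have "shift c u x \<in> carrier R" for x
      using u by (cases x) (simp add: M_def shift_def)
    ultimately show "t u \<in> M"
      unfolding c(2) M_def by simp
  next
    fix s :: "nat \<Rightarrow> nat \<times> (nat \<Rightarrow> rat)" assume sX: "\<And>i. s i \<in> X"
    have s: "fst (s i) < k" "snd (s i) \<in> L" for i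
      using sX[of i] by (auto simp: X_def)
    \<comment> \<open>with both \<open>fst (s i)\<close> and \<open>k - fst (s i)\<close> increasing, the component is constant\<close>
    define J where "J = {\<lambda>i. fst (s i), \<lambda>i. k - fst (s i)} \<union> (\<lambda>l i. lattice_coord d (snd (s i)) l) ` {..<n}"
    have "finite J" by (simp add: J_def)
    then obtain \<phi> where \<phi>: "strict_mono \<phi>" "\<And>u. u \<in> J \<Longrightarrow> incseq (u \<circ> \<phi>)"
      using common_incseq_subseq by blast
    show "\<exists>\<phi>::nat \<Rightarrow> nat. strict_mono \<phi> \<and> (\<forall>i j. i < j \<longrightarrow> (\<exists>t\<in>shift ` L. \<forall>v\<in>M.
      (\<forall>y. v y \<noteq> \<zero> \<longrightarrow> key y \<le> key (s (\<phi> i))) \<longrightarrow>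
      (\<forall>z. t v z \<noteq> \<zero> \<longrightarrow> key z \<le> key (s (\<phi> j))) \<and> t v (s (\<phi> j)) = v (s (\<phi> i))))"
    proof (intro exI conjI allI impI)
      show "strict_mono \<phi>" by (rule \<phi>)
      fix i j :: nat assume "i < j"
      then have mono: "u (\<phi> i) \<le> u (\<phi> j)" if "u \<in> J" for u
        using incseqD[OF \<phi>(2)[OF that], of i j] by simp
      obtain p a b where ab: "s (\<phi> i) = (p, a)" "s (\<phi> j) = (p, b)"
      proof -
        have "fst (s (\<phi> i)) = fst (s (\<phi> j))"
          using mono[of "\<lambda>i. fst (s i)"] mono[of "\<lambda>i. k - fst (s i)"] s[of "\<phi> i"] s[of "\<phi> j"]
          by (simp add: J_def)
        then show thesis using that by (metis prod.collapse)
      qed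
      have L: "a \<in> L" "b \<in> L" using s[of "\<phi> i"] s[of "\<phi> j"] ab by auto
      \<comment> \<open>The quotient of the two monomials: they lie in the same component, and the
        coordinates of \<open>a\<close> are at most those of \<open>b\<close>.\<close>
      define c where "c = b - a"
      have "0 \<le> c l" for l
      proof (cases "l < n")
        case True
        then have "lattice_coord d a l \<le> lattice_coord d b l"
          using mono[of "\<lambda>i. lattice_coord d (snd (s i)) l"] ab by (simp add: J_def)
        then have "of_nat d * a l \<le> of_nat d * b l"
          using coord_eq L by (metis of_nat_mono)
        then show ?thesis using d by (simp add: c_def)
      next
        case False
        then show ?thesis using L by (simp add: c_def L_def rat_exponents_def)
      qed
      then have c: "c \<in> L"
        using L lattice_diff[of b d a] by (simp add: c_def L_def rat_exponents_def)
      have "key (q, e) \<le> key (p, b)"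
        if v: "v \<in> M" "\<forall>y. v y \<noteq> \<zero> \<longrightarrow> key y \<le> key (p, a)" and "shift c v (q, e) \<noteq> \<zero>" for v q e
      proof -
        have nz: "v (q, e - c) \<noteq> \<zero>" using that by (simp add: shift_def)
        then have "(q, e - c) \<in> X" using v(1) unfolding M_def by blast
        then have "key (q, e - c + c) \<le> key (p, a + c)"
          using nz v(2) L c by (intro key_mono) (auto simp: X_def)
        then show ?thesis by (simp add: c_def)
      qed
      then show "\<exists>t\<in>shift ` L. \<forall>v\<in>M. (\<forall>y. v y \<noteq> \<zero> \<longrightarrow> key y \<le> key (s (\<phi> i))) \<longrightarrow>
        (\<forall>z. t v z \<noteq> \<zero> \<longrightarrow> key z \<le> key (s (\<phi> j))) \<and> t v (s (\<phi> j)) = v (s (\<phi> i))"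
        using c unfolding ab by (intro bexI[of _ "shift c"]) (auto simp: shift_def c_def)
    qed
  qed (auto simp: M_def)
  obtain B where B: "finite B" "B \<subseteq> M"
    "\<And>N. \<lbrakk>B \<subseteq> N; (\<lambda>x. \<zero>) \<in> N;
      \<And>u v. \<lbrakk>u \<in> N; v \<in> N; u \<in> M; v \<in> M\<rbrakk> \<Longrightarrow> (\<lambda>x. u x \<oplus> v x) \<in> N;
      \<And>r v. \<lbrakk>r \<in> carrier R; v \<in> N; v \<in> M\<rbrakk> \<Longrightarrow> (\<lambda>x. r \<otimes> v x) \<in> N;
      \<And>t v. \<lbrakk>t \<in> shift ` L; v \<in> N; v \<in> M\<rbrakk> \<Longrightarrow> t v \<in> N\<rbrakk> \<Longrightarrow> M \<subseteq> N"
    using finitely_generated by blast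
  have "lattice_part d k K \<subseteq> N" if N: "submodule N A (F k)" and BN: "vec ` B \<subseteq> N" for N
  proof -
    note N' = F.submoduleE[OF N]
    \<comment> \<open>The generation principle is applied to the preimage of \<open>N\<close> under
      \<open>vec\<close>.\<close>
    have "M \<subseteq> {u. vec u \<in> N}"
    proof (rule B(3))
      show "B \<subseteq> {u. vec u \<in> N}" using BN by blast
      show "(\<lambda>x. \<zero>) \<in> {u. vec u \<in> N}"
        using vec_zero F.zero_mem_submodule[OF N] by simp
      show "(\<lambda>x. u x \<oplus> v x) \<in> {u. vec u \<in> N}" if "u \<in> {u. vec u \<in> N}" "v \<in> {u. vec u \<in> N}" for u v
        using that N'(5) by (simp add: vec_add)
      show "(\<lambda>x. r \<otimes> u x) \<in> {u. vec u \<in> N}"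
        if "r \<in> carrier R" "u \<in> {u. vec u \<in> N}" "u \<in> M" for r u
        using that N'(4) monom_closed[OF that(1) zero_exponent] by (simp add: vec_smult)
      show "t u \<in> {u. vec u \<in> N}" if "t \<in> shift ` L" "u \<in> {u. vec u \<in> N}" "u \<in> M" for t u
        using that N'(4) monom_closed[OF one_closed] by (auto simp: vec_shift L_def)
    qed
    moreover have "h \<in> vec ` M" if h: "h \<in> lattice_part d k K" for h
    proof -
      \<comment> \<open>The flattening of \<open>h\<close>. Outside \<open>{..<k}\<close> the
        extensional function \<open>h\<close> is \<open>undefined\<close>, so zero is put there
        instead.\<close>
      define u where "u = (\<lambda>(j, a). if j < k then h j a else \<zero>)"
      have hF: "h \<in> carrier (F k)"
        using h K'(1) by (auto simp: lattice_part_def)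
      then have hA: "h j \<in> carrier A" if "j < k" for j
        using that by (auto simp: free_module_simps)
      have "vec u = h"
        using hF by (auto simp: vec_def u_def free_module_simps fun_eq_iff restrict_def PiE_def extensional_def)
      moreover have "{x. u x \<noteq> \<zero>} = (SIGMA j:{..<k}. {a. h j a \<noteq> \<zero>})"
        by (auto simp: u_def split: if_splits)
      then have "finite {x. u x \<noteq> \<zero>}"
        using hA finite_support by auto
      moreover have "u x \<in> carrier R" for x
        using hA by (cases x) (auto simp: u_def)
      moreover have "x \<in> X" if "u x \<noteq> \<zero>" for x
      proof -
        obtain j a where x: "x = (j, a)" by (cases x)
        with that have "j < k" "h j a \<noteq> \<zero>"
          by (auto simp: u_def split: if_splits)
        then show ?thesis
          using h hA[of j] x by (auto simp: lattice_part_def X_def L_def carrier_iff)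
      qed
      ultimately have "u \<in> M"
        using h by (simp add: M_def lattice_part_def)
      then show ?thesis
        using \<open>vec u = h\<close> by blast
    qed
    ultimately show ?thesis by blast
  qed
  moreover have "vec u \<in> lattice_part d k K" if "u \<in> M" for u
  proof -
    have "a \<in> denominator_lattice d" if "u (j, a) \<noteq> \<zero>" for j a
    proof -
      have "(j, a) \<in> X" using that \<open>u \<in> M\<close> unfolding M_def by blast
      then show ?thesis by (simp add: X_def L_def)
    qed
    then show ?thesis
      using that by (auto simp: lattice_part_def M_def vec_def)
  qed
  ultimately show ?thesis
    using B(1,2) by (intro exI[of _ "vec ` B"]) auto
qed

end

section \<open>Splitting syzygies by residue classes modulo the lattice\<close>

context noetherian_rat_poly
begin

text \<open>\<open>T\<^sup>-\<^sup>e\<close> times the part of \<open>h\<close> with exponents in the residue class of \<open>e\<close>.\<close>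

definition translate :: "nat \<Rightarrow> nat \<Rightarrow> (nat \<Rightarrow> rat) \<Rightarrow> (nat \<Rightarrow> (nat \<Rightarrow> rat) \<Rightarrow> 'a) \<Rightarrow> nat \<Rightarrow> (nat \<Rightarrow> rat) \<Rightarrow> 'a"
  where "translate d k e h = (\<lambda>j\<in>{..<k}. \<lambda>a. if a \<in> denominator_lattice d then h j (a + e) else \<zero>)"

text \<open>Dividing by a monomial could create negative exponents;
  \<open>lattice_add_residue_exponent\<close> excludes this for the lattice exponents that are
  kept.\<close>

lemma translate_closed:
  assumes d: "d > 0" and b: "b \<in> rat_exponents n" and h: "h \<in> carrier (F k)"
  shows "translate d k (residue d b) h \<in> carrier (F k)"
proof -
  let ?e = "residue d b"
  have "translate d k ?e h j \<in> carrier A" if j: "j < k" for j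
  proof -
    have hj: "h j \<in> carrier A"
      using h j by (auto simp: free_module_simps)
    have "{a. translate d k ?e h j a \<noteq> \<zero>} \<subseteq> (\<lambda>a. a - ?e) ` {a. h j a \<noteq> \<zero>}"
    proof
      fix a assume "a \<in> {a. translate d k ?e h j a \<noteq> \<zero>}"
      then have "h j (a + ?e) \<noteq> \<zero>"
        using j by (auto simp: translate_def split: if_splits)
      then show "a \<in> (\<lambda>a. a - ?e) ` {a. h j a \<noteq> \<zero>}"
        by (intro image_eqI[of _ _ "a + ?e"]) auto
    qed
    then have "finite {a. translate d k ?e h j a \<noteq> \<zero>}"
      by (rule finite_subset) (simp add: finite_support[OF hj])
    moreover have "a \<in> rat_exponents n" if "translate d k ?e h j a \<noteq> \<zero>" for a
    proof -
      have "a \<in> denominator_lattice d" "h j (a + ?e) \<noteq> \<zero>"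
        using that j by (auto simp: translate_def split: if_splits)
      then show ?thesis
        using hj lattice_add_residue_exponent[OF d _ b] by (auto simp: carrier_iff)
    qed
    moreover have "translate d k ?e h j a \<in> carrier R" for a
      using hj j by (simp add: translate_def)
    ultimately show ?thesis
      by (simp add: carrier_iff)
  qed
  then show ?thesis
    by (auto simp: free_module_simps translate_def)
qed

text \<open>Multiplication by \<open>f j\<close> preserves residue classes, because its exponents
  lie in the lattice. A relation therefore holds separately in each class and may be divided by the
  monomial of that class.\<close>

lemma translate_syzygies:
  assumes d: "d > 0" and b: "b \<in> rat_exponents n"
    and f: "f \<in> {..<k} \<rightarrow> carrier A" and f_lattice: "\<And>j c. \<lbrakk>j < k; f j c \<noteq> \<zero>\<rbrakk> \<Longrightarrow> c \<in> denominator_lattice d"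
    and h: "h \<in> A.syzygies k f"
  shows "translate d k (residue d b) h \<in> A.syzygies k f"
proof -
  let ?e = "residue d b"
  let ?t = "translate d k ?e h"
  have hF: "h \<in> carrier (F k)"
    using h by (simp add: A.syzygies_def)
  note tF = translate_closed[OF d b hF]
  have closed: "f j \<in> carrier A" "h j \<in> carrier A" "?t j \<in> carrier A" if "j < k" for j
    using that f hF tF by (auto simp: free_module_simps)
  have mult: "(?t j \<otimes>\<^bsub>A\<^esub> f j) c = (if c \<in> denominator_lattice d then (h j \<otimes>\<^bsub>A\<^esub> f j) (c + ?e) else \<zero>)"
    if j: "j < k" for j c
  proof -
    let ?S = "{a. f j a \<noteq> \<zero>}"
    have S: "finite ?S" using closed(1)[OF j] by (rule finite_support)
    \<comment> \<open>The product is expanded over the support of \<open>f j\<close>: for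
      \<open>a\<close> in the lattice, \<open>c - a\<close> lies in it exactly when \<open>c\<close>
      does.\<close>
    have tc: "?t j (c - a) = (if c \<in> denominator_lattice d then h j (c + ?e - a) else \<zero>)" if "a \<in> ?S" for a
      using that f_lattice[OF j] j lattice_diff_iff[of a d c]
      by (simp add: translate_def algebra_simps)
    have "(?t j \<otimes>\<^bsub>A\<^esub> f j) c = (\<Oplus>a\<in>?S. f j a \<otimes> ?t j (c - a))"
      unfolding mult_commute[OF closed(3,1)[OF j]]
      by (rule mult_apply[OF closed(1,3)[OF j] S]) auto
    also have "\<dots> = (\<Oplus>a\<in>?S. if c \<in> denominator_lattice d then f j a \<otimes> h j (c + ?e - a) else \<zero>)"
      using closed[OF j] by (intro finsum_cong' refl) (auto simp: tc)
    also have "\<dots> = (if c \<in> denominator_lattice d then \<Oplus>a\<in>?S. f j a \<otimes> h j (c + ?e - a) else \<zero>)"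
      by simp
    also have "(\<Oplus>a\<in>?S. f j a \<otimes> h j (c + ?e - a)) = (f j \<otimes>\<^bsub>A\<^esub> h j) (c + ?e)"
      by (rule mult_apply[OF closed(1,2)[OF j] S, symmetric]) auto
    finally show ?thesis
      using mult_commute[OF closed(1,2)[OF j]] by simp
  qed
  have "(\<Oplus>\<^bsub>A\<^esub>j\<in>{..<k}. ?t j \<otimes>\<^bsub>A\<^esub> f j) c = \<zero>" for c
  proof -
    have "(\<Oplus>\<^bsub>A\<^esub>j\<in>{..<k}. ?t j \<otimes>\<^bsub>A\<^esub> f j) c = (\<Oplus>j\<in>{..<k}. (?t j \<otimes>\<^bsub>A\<^esub> f j) c)"
      using closed mult_closed by (intro finsum_apply) auto
    also have "\<dots> = (\<Oplus>j\<in>{..<k}. if c \<in> denominator_lattice d then (h j \<otimes>\<^bsub>A\<^esub> f j) (c + ?e) else \<zero>)"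
      using closed mult_closed by (intro finsum_cong' refl) (auto simp: mult)
    also have "\<dots> = (if c \<in> denominator_lattice d then \<Oplus>j\<in>{..<k}. (h j \<otimes>\<^bsub>A\<^esub> f j) (c + ?e) else \<zero>)"
      by simp
    also have "(\<Oplus>j\<in>{..<k}. (h j \<otimes>\<^bsub>A\<^esub> f j) (c + ?e)) = (\<Oplus>\<^bsub>A\<^esub>j\<in>{..<k}. h j \<otimes>\<^bsub>A\<^esub> f j) (c + ?e)"
      using closed mult_closed by (intro finsum_apply[symmetric]) auto
    also have "\<dots> = \<zero>"
      using h by (simp add: A.syzygies_def zero_apply)
    finally show ?thesis by simp
  qed
  then show ?thesis
    using tF by (auto simp: A.syzygies_def zero_apply fun_eq_iff)
qed

text \<open>A syzygy is the finite sum of its residue components, and each of these is a monomial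
  times a translate belonging to \<open>lattice_part\<close>.\<close>

lemma syzygies_subset_submodule:
  assumes d: "d > 0"
    and f: "f \<in> {..<k} \<rightarrow> carrier A" and f_lattice: "\<And>j c. \<lbrakk>j < k; f j c \<noteq> \<zero>\<rbrakk> \<Longrightarrow> c \<in> denominator_lattice d"
    and N: "submodule N A (F k)" and sub: "lattice_part d k (A.syzygies k f) \<subseteq> N"
  shows "A.syzygies k f \<subseteq> N"
proof
  interpret F: module A "F k" by (rule A.free_module_is_module)
  fix h assume h: "h \<in> A.syzygies k f"
  then have hF: "h \<in> carrier (F k)"
    by (simp add: A.syzygies_def)
  then have hA: "h j \<in> carrier A" if "j < k" for j
    using that by (auto simp: free_module_simps)
  \<comment> \<open>The partial sum of the components of \<open>h\<close> with residues in
    \<open>U\<close>; inserting \<open>e\<close> into \<open>U\<close> adds the monomial with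
    exponent \<open>e\<close> times the translate for \<open>e\<close>.\<close>
  define part where "part U = (\<lambda>j\<in>{..<k}. \<lambda>c. if residue d c \<in> U then h j c else \<zero>)" for U
  have part: "part U \<in> N" if "finite U" "U \<subseteq> residue d ` rat_exponents n" for U
    using that
  proof (induction U)
    case empty
    have "part {} = \<zero>\<^bsub>F k\<^esub>"
      by (auto simp: part_def free_module_simps zero_apply fun_eq_iff restrict_def)
    then show ?case using F.zero_mem_submodule[OF N] by simp
  next
    case (insert e U)
    then obtain b where b: "b \<in> rat_exponents n" "e = residue d b" by blast
    let ?t = "translate d k e h"
    have eE: "e \<in> rat_exponents n"
      using b residue_exponent by blast
    have "?t \<in> A.syzygies k f"
      using translate_syzygies[OF d b(1) f f_lattice h] by (simp add: b(2))
    then have "?t \<in> lattice_part d k (A.syzygies k f)"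
      by (auto simp: lattice_part_def translate_def split: if_splits)
    then have "monom \<one> e \<odot>\<^bsub>F k\<^esub> ?t \<in> N"
      using sub monom_closed[OF one_closed eE] F.submoduleE(4)[OF N] by blast
    moreover have "part (insert e U) = part U \<oplus>\<^bsub>F k\<^esub> (monom \<one> e \<odot>\<^bsub>F k\<^esub> ?t)"
    proof -
      have "(monom \<one> e \<otimes>\<^bsub>A\<^esub> ?t j) c = (if residue d c = e then h j c else \<zero>)" if j: "j < k" for j c
      proof -
        have "?t j \<in> carrier A"
          using translate_closed[OF d b(1) hF] j by (auto simp: b(2) free_module_simps)
        then have "(monom \<one> e \<otimes>\<^bsub>A\<^esub> ?t j) c = ?t j (c - e)"
          by (simp add: monom_mult_apply eE)
        then show ?thesis
          using j diff_residue_lattice_iff[OF d, of c b] by (simp add: translate_def b(2))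
      qed
      then show ?thesis
        using insert.hyps hA
        by (intro ext) (auto simp: part_def free_module_simps add_apply restrict_def)
    qed
    ultimately show ?case
      using insert F.submoduleE(5)[OF N] by simp
  qed
  \<comment> \<open>All residues occurring in \<open>h\<close>, so that the partial sum over
    \<open>?U\<close> discards no term.\<close>
  let ?U = "residue d ` (\<Union>j<k. {c. h j c \<noteq> \<zero>})"
  have "part ?U = h"
  proof (rule free_module_eqI[OF _ hF])
    have eq: "part ?U j = h j" if "j < k" for j
    proof
      fix c
      have "residue d c \<in> ?U" if "h j c \<noteq> \<zero>"
        using that \<open>j < k\<close> by blast
      then show "part ?U j c = h j c"
        using \<open>j < k\<close> by (cases "h j c = \<zero>") (simp_all add: part_def)
    qed
    then show "part ?U j = h j" if "j < k" for j
      using that .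
    show "part ?U \<in> carrier (F k)"
      unfolding free_module_simps
    proof (rule PiE_I)
      show "part ?U j \<in> carrier A" if "j \<in> {..<k}" for j
        using eq[of j] hA[of j] that by simp
    qed (simp add: part_def)
  qed
  moreover have "part ?U \<in> N"
  proof (rule part)
    show "finite ?U"
      using hA finite_support by (intro finite_imageI finite_UN_I) auto
    have "c \<in> rat_exponents n" if "j < k" "h j c \<noteq> \<zero>" for j c
      using hA[OF that(1)] that(2) by (simp add: carrier_iff)
    then show "?U \<subseteq> residue d ` rat_exponents n"
      by (intro image_mono) blast
  qed
  ultimately show "h \<in> N" by simp
qed

lemma coherent_A: "coherent_ring A"
proof (rule A.coherent_ringI)
  fix k :: nat and f assume f: "f \<in> {..<k} \<rightarrow> carrier A"
  let ?S = "\<Union>j<k. {c. f j c \<noteq> \<zero>}"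
  have "finite ?S"
    using f finite_support by (intro finite_UN_I) auto
  moreover have "?S \<subseteq> rat_exponents n"
    using f by (auto simp: carrier_iff Pi_def)
  ultimately obtain d where d: "d > 0" "?S \<subseteq> denominator_lattice d"
    using exponents_common_denominator by blast
  then have f_lattice: "c \<in> denominator_lattice d" if "j < k" "f j c \<noteq> \<zero>" for j c
    using that by blast
  obtain B where B: "finite B" "B \<subseteq> lattice_part d k (A.syzygies k f)"
    "\<And>N. \<lbrakk>submodule N A (F k); B \<subseteq> N\<rbrakk> \<Longrightarrow> lattice_part d k (A.syzygies k f) \<subseteq> N"
    using lattice_part_finitely_generated[OF d(1) A.syzygies_submodule[OF f]] by metis
  have "A.syzygies k f \<subseteq> N" if "submodule N A (F k)" "B \<subseteq> N" for N
    using syzygies_subset_submodule[OF d(1) f f_lattice that(1) B(3)[OF that]] .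
  moreover have "B \<subseteq> A.syzygies k f"
    using B(2) by (auto simp: lattice_part_def)
  ultimately show "\<exists>B. finite B \<and> B \<subseteq> A.syzygies k f \<and>
      (\<forall>N. submodule N A (F k) \<longrightarrow> B \<subseteq> N \<longrightarrow> A.syzygies k f \<subseteq> N)"
    using B(1) by blast
qed

end

theorem mainTheorem2:
  fixes R :: "('a, 'm) ring_scheme" and n :: nat
  assumes "cring R" and "noetherian_ring R" and "n > 0"
  shows "coherent_ring (rat_poly_ring R n)"
proof -
  interpret noetherian_rat_poly R n "rat_poly_ring R n"
    using assms by (simp add: noetherian_rat_poly_def)
  show ?thesis by (rule coherent_A)
qed

end
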